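(* Let $K$ be a field containing an element of multiplicative order $6$. Then $\beta_{\mathrm{sep}}^K(\mathrm{S}_3\times \mathrm{C}_3)=6$, where $\mathrm{S}_3$ is the symmetric group of degree $3$ and $\mathrm{C}_3$ is the group of order $3$.
   Context: Let $K$ be a field and $G$ a finite group with $\mathrm{char}(K)\nmid |G|$. For a finite dimensional $KG$-module $V$, $K[V]$ is the polynomial ring in the coordinate functions on $V$, on which $G$ acts by $(g\cdot f)(v)=f(g^{-1}v)$, and $K[V]^G$ is the subalgebra of $G$-invariants. A subset $S\subseteq K[V]^G$ is a separating set if whenever $v,w\in V$ have different $G$-orbits, there is $f\in S$ with $f(v)\ne f(w)$. The number $\beta_{\mathrm{sep}}(G,V)$ is the minimal positive integer $d$ such that the elements of $K[V]^G$ of degree at most $d$ form a separating set, and $\beta_{\mathrm{sep}}^K(G)$ is the supremum of $\beta_{\mathrm{sep}}(G,V)$ over all finite dimensional $KG$-modules $V$. *)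

theory Defs
  imports
    "HOL-Library.Poly_Mapping"
    "HOL-Library.Extended_Nat"
    "HOL-Algebra.Group_Action"
    "HOL-Algebra.Sym_Groups"
    "HOL-Algebra.Elementary_Groups"
    "Jordan_Normal_Form.Matrix"
begin

definition has_mult_order :: "'k::field \<Rightarrow> nat \<Rightarrow> bool" where
  "has_mult_order a n \<longleftrightarrow> n > 0 \<and> a ^ n = 1 \<and> (\<forall>m. 0 < m \<and> m < n \<longrightarrow> a ^ m \<noteq> 1)"

text \<open>
  Multivariate polynomials are finitely supported maps from exponent vectors to coefficients;
  they are formal objects, not polynomial functions (the two differ over a finite field).
  The library multiplication on this type is polynomial multiplication.
\<close>

type_synonym 'k mpoly = "(nat \<Rightarrow>\<^sub>0 nat) \<Rightarrow>\<^sub>0 'k"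

definition mpoly_ring :: "nat \<Rightarrow> 'k::field mpoly set" where
  "mpoly_ring n = {f. \<forall>m \<in> Poly_Mapping.keys f. Poly_Mapping.keys m \<subseteq> {..<n}}"

definition mpoly_const :: "'k::field \<Rightarrow> 'k mpoly" where
  "mpoly_const c = Poly_Mapping.single 0 c"

definition mpoly_var :: "nat \<Rightarrow> 'k::field mpoly" where
  "mpoly_var i = Poly_Mapping.single (Poly_Mapping.single i 1) 1"

text \<open>The zero polynomial gets total degree 0.\<close>

definition total_degree :: "'k::field mpoly \<Rightarrow> nat" where
  "total_degree f = Max (insert 0 ((\<lambda>m. \<Sum>i \<in> Poly_Mapping.keys m. Poly_Mapping.lookup m i) ` Poly_Mapping.keys f))"

text \<open>
  Value of \<open>f\<close> when coefficients are mapped by \<open>c\<close> and the variable with index \<open>i\<close>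
  is replaced by \<open>x i\<close>.
\<close>

definition mpoly_subst ::
    "('k::field \<Rightarrow> 'r::comm_ring_1) \<Rightarrow> (nat \<Rightarrow> 'r) \<Rightarrow> 'k mpoly \<Rightarrow> 'r" where
  "mpoly_subst c x f = (\<Sum>m \<in> Poly_Mapping.keys f. c (Poly_Mapping.lookup f m) * (\<Prod>i \<in> Poly_Mapping.keys m. x i ^ Poly_Mapping.lookup m i))"

definition mpoly_eval :: "'k::field mpoly \<Rightarrow> 'k vec \<Rightarrow> 'k" where
  "mpoly_eval f v = mpoly_subst (\<lambda>a. a) (\<lambda>i. v $ i) f"

text \<open>
  A \<open>KG\<close>-module of dimension \<open>n\<close> is, after choosing a basis, \<open>K\<^sup>n\<close> with a homomorphism from
  \<open>G\<close> to the group of invertible \<open>n \<times> n\<close> matrices, acting on column vectors.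
\<close>

definition representation ::
    "('g, 'b) monoid_scheme \<Rightarrow> nat \<Rightarrow> ('g \<Rightarrow> 'k::field mat) \<Rightarrow> bool" where
  "representation G n \<rho> \<longleftrightarrow> \<rho> \<in> hom G (units_of (ring_mat TYPE('k) n ()))"

definition module_orbit ::
    "('g, 'b) monoid_scheme \<Rightarrow> ('g \<Rightarrow> 'k::field mat) \<Rightarrow> 'k vec \<Rightarrow> 'k vec set" where
  "module_orbit G \<rho> v = orbit G (\<lambda>g w. \<rho> g *\<^sub>v w) v"

text \<open>
  The polynomial \<open>g \<cdot> f\<close> with \<open>(g \<cdot> f) v = f (g\<^sup>-\<^sup>1 v)\<close>: the \<open>i\<close>-th coordinate of \<open>g\<^sup>-\<^sup>1 v\<close>
  is \<open>\<Sum>j<n. \<rho> g\<^sup>-\<^sup>1 $$ (i, j) * v $ j\<close>, and this linear form is substituted for variable \<open>i\<close>.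
\<close>

definition poly_action ::
    "('g, 'b) monoid_scheme \<Rightarrow> nat \<Rightarrow> ('g \<Rightarrow> 'k::field mat) \<Rightarrow> 'g \<Rightarrow> 'k mpoly \<Rightarrow> 'k mpoly" where
  "poly_action G n \<rho> g f =
     mpoly_subst mpoly_const
       (\<lambda>i. \<Sum>j<n. mpoly_const (\<rho> (inv\<^bsub>G\<^esub> g) $$ (i, j)) * mpoly_var j) f"

definition invariants ::
    "('g, 'b) monoid_scheme \<Rightarrow> nat \<Rightarrow> ('g \<Rightarrow> 'k::field mat) \<Rightarrow> 'k mpoly set" where
  "invariants G n \<rho> = {f \<in> mpoly_ring n. \<forall>g \<in> carrier G. poly_action G n \<rho> g f = f}"

definition separating_set ::
    "('g, 'b) monoid_scheme \<Rightarrow> nat \<Rightarrow> ('g \<Rightarrow> 'k::field mat) \<Rightarrow> 'k mpoly set \<Rightarrow> bool" where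
  "separating_set G n \<rho> S \<longleftrightarrow>
     S \<subseteq> invariants G n \<rho> \<and>
     (\<forall>v \<in> carrier_vec n. \<forall>w \<in> carrier_vec n.
        module_orbit G \<rho> v \<noteq> module_orbit G \<rho> w \<longrightarrow> (\<exists>f \<in> S. mpoly_eval f v \<noteq> mpoly_eval f w))"

text \<open>
  Minimum over positive integers, taken in \<^typ>\<open>enat\<close> so that it would be \<open>\<infinity>\<close> if no degree
  bound gave a separating set (this does not happen for finite \<open>G\<close>).
\<close>

definition beta_sep_module ::
    "('g, 'b) monoid_scheme \<Rightarrow> nat \<Rightarrow> ('g \<Rightarrow> 'k::field mat) \<Rightarrow> enat" where
  "beta_sep_module G n \<rho> =
     Inf {enat d | d. d > 0 \<and> separating_set G n \<rho> {f \<in> invariants G n \<rho>. total_degree f \<le> d}}"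

text \<open>The field enters only through its type, hence the \<open>itself\<close> argument.\<close>

definition beta_sep :: "'k::field itself \<Rightarrow> ('g, 'b) monoid_scheme \<Rightarrow> enat" where
  "beta_sep K G =
     Sup {beta_sep_module G n \<rho> | n (\<rho> :: 'g \<Rightarrow> 'k mat). representation G n \<rho>}"

end

(*
  Lower bound: a faithful character of the quotient C_6 has no nonconstant invariant of degree
  below 6.

  Upper bound: let A = C_3 x C_3 be the subgroup of index 2 and t a transposition. Averaging
  products of at most 6 linear forms that are weight vectors for A shows: if v and w agree on all
  invariants of degree at most 6, then h(v) + h(tv) = h(w) + h(tw) for every A-invariant monomial h
  of degree at most 6. Products of two A-invariants of degree at most 3 show that, after possibly
  replacing w by tw, all A-invariants of degree at most 3 agree on v and w. Hence each weight
  component of w is a cube root of unity times that of v. If these scalars depend additively on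
  the weight, then w lies in Av. Otherwise an A-invariant of degree 4 separates v and w, and the
  relation above forces enough weights to occur in both v and tv that w lies in A(tv).
*)

theory Submission
  imports Defs "HOL-Library.Numeral_Type" "HOL-Library.Product_Plus"
begin

section \<open>Weights and exponents modulo 3\<close>

text \<open>The difficulty is that agreement on A-invariants of degree at most 3 does not make the
  scalars additive. Three lines of F_3^2 carry a zero-sum triple only for one choice of signs, up to
  a global sign. If the weights occur with other signs, the relation becomes visible only after
  replacing some c by two copies of -c, which costs degree 4. The product of two such invariants has
  degree 8, so in degree 4 only the sum of the values at v and tv is under control, not each value.

  Suppose h(w) = \<omega>^s h(v) and h(tw) = \<omega>^s' h(tv). The sum relation then reads h(v)(1 -
  \<omega>^s) = h(tv)(\<omega>^s' - 1). For s = s' nonzero it says h(tv) = - h(v); for s' = - s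
  nonzero it says h(tv) = \<omega>^s h(v). Failure of additivity always leads to one of two
  configurations of weights. In one of them a monomial of the first kind contradicts t being an
  involution; in the other, monomials of the second kind exhibit tv as a copy of v with components
  rescaled by cube roots of unity.\<close>

lemma UNIV_3: "(UNIV :: 3 set) = {0, 1, 2}"
proof -
  have "card {0, 1, 2 :: 3} = card (UNIV :: 3 set)"
    by simp
  then show ?thesis
    using card_subset_eq[of "UNIV :: 3 set" "{0, 1, 2}"] by simp
qed

lemma cases_3: "(a :: 3) = 0 \<or> a = 1 \<or> a = 2"
  using UNIV_I[of a] unfolding UNIV_3 by blast

lemma cases_3_unit:
  assumes "e \<noteq> (0 :: 3)"
  shows "a = 0 \<or> a = e \<or> a = - e"
  using assms cases_3[of a] cases_3[of e] by auto

lemma uminus_numerals_3 [simp]: "- 1 = (2 :: 3)" "- 2 = (1 :: 3)"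
  by simp_all

lemma three_times_3: "a + a + a = (0 :: 3)" 
  using cases_3[of a] by auto

lemma three_mult_3 [simp]: "3 * a = (0 :: 3)" "a * 3 = (0 :: 3)"
proof -
  have "(3 :: 3) = 0"
    by simp
  then show "3 * a = 0" "a * 3 = 0"
    by (simp_all only: mult_zero_left mult_zero_right)
qed

lemma square_3: "e \<noteq> 0 \<Longrightarrow> e * e = (1 :: 3)"
  using cases_3[of e] by auto

lemma eq_uminus_3: "(a :: 3) = - a \<longleftrightarrow> a = 0"
  using cases_3[of a] by auto

section \<open>Cube roots of unity and vectors up to scalars\<close>

definition cpow :: "'k::field \<Rightarrow> 3 \<Rightarrow> 'k" where
  "cpow \<omega> i = (if i = 0 then 1 else if i = 1 then \<omega> else \<omega> ^ 2)"

lemma cpow_0 [simp]: "cpow \<omega> 0 = 1"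
  by (simp add: cpow_def)

lemma cpow_add:
  assumes "\<omega> ^ 3 = 1"
  shows "cpow \<omega> (i + j) = cpow \<omega> i * cpow \<omega> j"
proof -
  have "\<omega> * \<omega>\<^sup>2 = 1" "\<omega>\<^sup>2 * \<omega> = 1" "\<omega>\<^sup>2 * \<omega>\<^sup>2 = \<omega>"
    using assms by (simp_all add: power2_eq_square power3_eq_cube mult.assoc)
  then show ?thesis
    using cases_3[of i] cases_3[of j] by (auto simp: cpow_def power2_eq_square)
qed

lemma cpow_nonzero: "\<omega> ^ 3 = 1 \<Longrightarrow> cpow \<omega> i \<noteq> (0 :: 'k::field)"
  by (auto simp: cpow_def)

lemma cpow_eq_1_iff:
  assumes "\<omega> ^ 3 = 1" "\<omega> \<noteq> (1 :: 'k::field)"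
  shows "cpow \<omega> i = 1 \<longleftrightarrow> i = 0"
proof -
  have "\<omega>\<^sup>2 \<noteq> 1"
    using assms by (auto simp: power2_eq_square power3_eq_cube)
  then show ?thesis
    using assms cases_3[of i] by (auto simp: cpow_def)
qed

lemma cube_root_of_unity_sum:
  assumes "\<omega> ^ 3 = 1" "\<omega> \<noteq> (1 :: 'k::field)"
  shows "\<omega>\<^sup>2 + \<omega> + 1 = 0"
proof -
  have "(\<omega> - 1) * (\<omega>\<^sup>2 + \<omega> + 1) = \<omega> ^ 3 - 1"
    by (simp add: algebra_simps power2_eq_square power3_eq_cube)
  then show ?thesis
    using assms by simp
qed

lemma cube_root_cases:
  assumes "\<omega> ^ 3 = 1" "\<omega> \<noteq> (1 :: 'k::field)" "c ^ 3 = 1"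
  obtains k where "c = cpow \<omega> k"
proof -
  have "(c - 1) * ((c - \<omega>) * (c - \<omega>\<^sup>2)) =
      c ^ 3 - \<omega> ^ 3 - c\<^sup>2 * (\<omega>\<^sup>2 + \<omega> + 1) + c * (\<omega>\<^sup>2 + \<omega> + \<omega> ^ 3)"
    by (simp add: algebra_simps power2_eq_square power3_eq_cube)
  also have "\<dots> = 0"
    using cube_root_of_unity_sum[OF assms(1,2)] assms(1,3) by simp
  finally have "(c - 1) * ((c - \<omega>) * (c - \<omega>\<^sup>2)) = 0" .
  then have "c = cpow \<omega> 0 \<or> c = cpow \<omega> 1 \<or> c = cpow \<omega> 2"
    by (auto simp: cpow_def)
  then show ?thesis
    using that by blast
qed

definition smul :: "'k::field \<Rightarrow> ('i \<Rightarrow> 'k) \<Rightarrow> 'i \<Rightarrow> 'k" where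
  "smul c f = (\<lambda>i. c * f i)"

abbreviation zerofun :: "'i \<Rightarrow> 'k::field" where
  "zerofun \<equiv> \<lambda>_. 0"

lemma smul_0 [simp]: "smul 0 f = zerofun" and smul_1 [simp]: "smul 1 f = f"
  and smul_zerofun [simp]: "smul c zerofun = zerofun"
  and smul_smul: "smul c (smul d f) = smul (c * d) f"
  by (simp_all add: smul_def mult.assoc)

lemma nonzero_funE:
  assumes "f \<noteq> zerofun" obtains i where "f i \<noteq> 0"
  using assms by auto

text \<open>A tensor \<open>f \<otimes> f \<otimes> f\<close> determines \<open>f\<close> up to a
  cube root of unity: the scalar is read off at one nonzero coordinate, and taking all three indices
  there shows that its cube is 1.\<close>

lemma cubes_eq_imp_smul:
  assumes "\<And>i j k. f i * f j * f k = g i * g j * (g k :: 'k::field)"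
  obtains c where "c ^ 3 = 1" "g = smul c f"
proof (cases "f = zerofun")
  case True
  then have "g i * g i * g i = 0" for i
    using assms[of i i i] by simp
  then have "g = zerofun"
    by auto
  then show ?thesis
    using True that[of 1] by simp
next
  case False
  then obtain a where a: "f a \<noteq> 0"
    by (rule nonzero_funE)
  define c where "c = g a / f a"
  have ga: "g a = c * f a"
    using a by (simp add: c_def)
  have "f a ^ 3 = c ^ 3 * f a ^ 3"
    using assms[of a a a] unfolding ga by (simp add: power3_eq_cube mult_ac)
  then have c3: "c ^ 3 = 1"
    using a by simp
  have "g k = c * f k" for k
  proof -
    have "f a * f a * f k = (c * f a) * (c * f a) * g k"
      using assms[of a a k] unfolding ga .
    \<comment> \<open>The extra factor \<open>c\<close> completes \<open>c ^ 3\<close> on the right,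
      which is 1.\<close>
    then have "c * (f a * f a * f k) = c * ((c * f a) * (c * f a) * g k)"
      by simp
    then have "(f a * f a) * (c * f k) = (f a * f a) * (c ^ 3 * g k)"
      by (simp only: power3_eq_cube mult_ac)
    then show ?thesis
      using a c3 by simp
  qed
  then show ?thesis
    using c3 that[of c] by (auto simp: smul_def)
qed

text \<open>Meant for an identity between two monomials in which one factor varies and the others,
  collected in \<open>b\<close> and \<open>a\<close>, are frozen. Nonvanishing of \<open>b\<close>
  follows from that of \<open>a\<close>.\<close>

lemma proportional:
  assumes "\<And>i. f' i * b = f i * (a :: 'k::field)" "f \<noteq> zerofun" "a \<noteq> 0"
  obtains c where "f' = smul c f"
proof -
  obtain i where "f i \<noteq> 0"
    using assms(2) by (rule nonzero_funE)
  then have "b \<noteq> 0"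
    using assms(1)[of i] assms(3) by auto
  then have "f' = smul (a / b) f"
    using assms(1) by (auto simp: smul_def field_simps)
  then show ?thesis
    by (rule that)
qed

text \<open>An entry \<open>(a, i)\<close> stands for coordinate \<open>i\<close> of the component
  of weight \<open>a\<close>. The length is the degree, and the sum of the weights is the character
  by which C_3 x C_3 acts, so weight 0 means invariant. Lists concatenate, which makes products of
  invariants immediate.\<close>

definition mon :: "('a \<Rightarrow> 'i \<Rightarrow> 'k::field) \<Rightarrow> ('a \<times> 'i) list \<Rightarrow> 'k" where
  "mon f l = prod_list (map (\<lambda>(a, i). f a i) l)"

lemma mon_Nil [simp]: "mon f [] = 1"
  and mon_Cons [simp]: "mon f ((a, i) # l) = f a i * mon f l"
  and mon_append: "mon f (l @ m) = mon f l * mon f m"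
  by (simp_all add: mon_def)

abbreviation weight :: "('a::monoid_add \<times> 'i) list \<Rightarrow> 'a" where
  "weight l \<equiv> sum_list (map fst l)"

text \<open>Weights of \<open>C\<^sub>3 \<times> C\<^sub>3\<close>; a transposition in \<open>S\<^sub>3\<close> inverts the first factor.\<close>

definition flip :: "3 \<times> 3 \<Rightarrow> 3 \<times> 3" where
  "flip a = (- fst a, snd a)"

text \<open>Identifies C_3 x C_3 with its character group: the first argument is a weight, the
  second a group element.\<close>

definition pairing :: "3 \<times> 3 \<Rightarrow> 3 \<times> 3 \<Rightarrow> 3" where
  "pairing a u = fst a * fst u + snd a * snd u"

lemma flip_flip [simp]: "flip (flip a) = a"
  and flip_Pair [simp]: "flip (i, j) = (- i, j)"
  and flip_0 [simp]: "flip 0 = 0"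
  by (simp_all add: flip_def zero_prod_def)

lemma weight_eq_0_iff [simp]: "((i :: 3), (j :: 3)) = 0 \<longleftrightarrow> i = 0 \<and> j = 0"
  by (simp add: zero_prod_def)

text \<open>
  If \<open>V\<close> and \<open>V'\<close> are the vectors of values of all monomials of degree at most 3, then moments of
  degree at most 6 give \<open>V + V'\<close> and \<open>(V - V') \<otimes> (V - V')\<close>, hence \<open>V - V'\<close> up to sign.
\<close>

lemma pairs_agree_or_swap:
  fixes v v' w w' :: "'a::monoid_add \<Rightarrow> 'i \<Rightarrow> 'k::field"
  assumes two: "(2 :: 'k) \<noteq> 0"
    and E: "\<And>l. length l \<le> 6 \<Longrightarrow> weight l = 0 \<Longrightarrow> mon v l + mon v' l = mon w l + mon w' l"
  shows "(\<forall>l. length l \<le> 3 \<longrightarrow> weight l = 0 \<longrightarrow> mon v l = mon w l) \<or>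
         (\<forall>l. length l \<le> 3 \<longrightarrow> weight l = 0 \<longrightarrow> mon v l = mon w' l)"
proof -
  define Z where "Z l \<longleftrightarrow> length l \<le> 3 \<and> weight l = 0" for l :: "('a \<times> 'i) list"
  define D where "D l = mon v l - mon v' l" for l
  define F where "F l = mon w l - mon w' l" for l
  have s: "mon v l + mon v' l = mon w l + mon w' l" if "Z l" for l
    using E[of l] that by (simp add: Z_def)
  \<comment> \<open>Polarisation: \<open>D l * D m\<close> is a combination of sums over the pair
    \<open>v, v'\<close>, and the longest list involved, \<open>l @ m\<close>, still has length at
    most 6.\<close>
  have DF: "D l * D m = F l * F m" if "Z l" "Z m" for l m
  proof -
    have "mon v l * mon v m + mon v' l * mon v' m = mon w l * mon w m + mon w' l * mon w' m"
      using E[of "l @ m"] that by (simp add: Z_def mon_append)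
    moreover have "D l * D m = 2 * (mon v l * mon v m + mon v' l * mon v' m)
        - (mon v l + mon v' l) * (mon v m + mon v' m)"
      "F l * F m = 2 * (mon w l * mon w m + mon w' l * mon w' m)
        - (mon w l + mon w' l) * (mon w m + mon w' m)"
      by (simp_all add: D_def F_def algebra_simps)
    ultimately show ?thesis
      using s[OF that(1)] s[OF that(2)] by simp
  qed
  have half: "a = b" if "2 * a = 2 * b" for a b :: 'k
    using that two by simp
  consider "\<forall>l. Z l \<longrightarrow> D l = F l" | "\<forall>l. Z l \<longrightarrow> D l = - F l"
  \<comment> \<open>The sign is fixed at one \<open>l\<close> with \<open>D l \<noteq> 0\<close>;
    the mixed products \<open>D l * D m\<close> carry the same sign to every
    \<open>m\<close>.\<close>
  proof (cases "\<exists>l. Z l \<and> D l \<noteq> 0")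
    case True
    then obtain l where l: "Z l" "D l \<noteq> 0"
      by blast
    have "(D l - F l) * (D l + F l) = 0"
      using DF[OF l(1) l(1)] by (simp add: algebra_simps)
    then consider "F l = D l" | "F l = - D l"
      by (auto simp: eq_neg_iff_add_eq_0 add.commute)
    then show ?thesis
    proof cases
      case 1
      have "D m = F m" if "Z m" for m
        using DF[OF l(1) that] l(2) unfolding 1 by simp
      then show ?thesis
        using that by blast
    next
      case 2
      have "D m = - F m" if "Z m" for m
        using DF[OF l(1) that] l(2) unfolding 2 by (simp add: minus_mult_right del: minus_mult_right[symmetric])
      then show ?thesis
        using that by blast
    qed
  next
    case False
    have "F l = 0" if "Z l" for l
      using DF[OF that that] False that by auto
    then show ?thesis
      using that(1) False by auto
  qed
  then show ?thesis
  proof cases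
    case 1
    have "mon v l = mon w l" if "Z l" for l
    proof (rule half)
      have "2 * mon v l = (mon v l + mon v' l) + D l" "2 * mon w l = (mon w l + mon w' l) + F l"
        by (simp_all add: D_def F_def)
      then show "2 * mon v l = 2 * mon w l"
        using 1 s[OF that] that by simp
    qed
    then show ?thesis
      by (simp add: Z_def)
  next
    case 2
    have "mon v l = mon w' l" if "Z l" for l
    proof (rule half)
      have "2 * mon v l = (mon v l + mon v' l) + D l" "2 * mon w' l = (mon w l + mon w' l) - F l"
        by (simp_all add: D_def F_def)
      then show "2 * mon v l = 2 * mon w' l"
        using 2 s[OF that] that by simp
    qed
    then show ?thesis
      by (simp add: Z_def)
  qed
qed

section \<open>Odd functions on the weights and the obstructions to linearity\<close>

text \<open>
  \<open>P\<close> is the set of weights occurring in \<open>v\<close>, and the component of \<open>w\<close> of weight \<open>a\<close> is \<open>\<omega>\<close> to the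
  power \<open>L a\<close> times that of \<open>v\<close>. The points \<open>v\<close> and \<open>w\<close> are conjugate under \<open>C\<^sub>3 \<times> C\<^sub>3\<close> iff \<open>L\<close> is linear on
  \<open>P\<close>. The hypothesis \<open>quadruple\<close> says that an invariant of degree 4 separating \<open>v\<close> from \<open>w\<close> cannot
  vanish at the image of \<open>v\<close> under the transposition.
\<close>

locale odd_exponents =
  fixes P :: "3 \<times> 3 \<Rightarrow> bool" and L :: "3 \<times> 3 \<Rightarrow> 3"
  assumes L_uminus: "L (- a) = - L a"
    and triple: "a + b + c = 0 \<Longrightarrow> P a \<Longrightarrow> P b \<Longrightarrow> P c \<Longrightarrow> L a + L b + L c = 0"
    and quadruple: "a + b + c + c = 0 \<Longrightarrow> P a \<Longrightarrow> P b \<Longrightarrow> P c \<Longrightarrow>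
           L a + L b + L c + L c \<noteq> 0 \<Longrightarrow> P (flip a) \<and> P (flip b) \<and> P (flip c)"
begin

lemma L_neg: "L (- i, - j) = - L (i, j)"
  using L_uminus[of "(i, j)"] by simp

lemma L_22: "L (2, 2) = - L (1, 1)" and L_12: "L (1, 2) = - L (2, 1)"
  and L_20: "L (2, 0) = - L (1, 0)" and L_02: "L (0, 2) = - L (0, 1)" and L_00: "L (0, 0) = 0"
  using L_neg[of 1 1] L_neg[of 2 1] L_neg[of 1 0] L_neg[of 0 1] L_neg[of 0 0]
  by (simp_all add: eq_uminus_3)

text \<open>Since \<open>L\<close> is odd, linearity only concerns lines through 0, so a weight is
  counted as soon as it occurs with one of its signs.\<close>

definition present :: "3 \<times> 3 \<Rightarrow> bool" where
  "present a \<longleftrightarrow> P a \<or> P (- a)"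

text \<open>Some sign of \<open>a\<close> occurs together with its flip. For \<open>(1, 0)\<close>,
  which \<open>flip\<close> negates, this forces both signs to occur; for \<open>(0, 1)\<close>,
  which \<open>flip\<close> fixes, it is the same as \<open>present\<close>.\<close>

definition both :: "3 \<times> 3 \<Rightarrow> bool" where
  "both a \<longleftrightarrow> P a \<and> P (flip a) \<or> P (- a) \<and> P (flip (- a))"

definition bad :: "3 \<times> 3 \<Rightarrow> 3 \<times> 3 \<Rightarrow> 3 \<times> 3 \<Rightarrow> bool" where
  "bad a b c \<longleftrightarrow> L a + L b + L c \<noteq> 0 \<and> present a \<and> present b \<and> present c"

text \<open>By \<open>triple\<close>, the signs that occur cannot match the relation
  \<open>a + b + c = 0\<close> or its negative. Hence one weight, say \<open>c\<close>, occurs with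
  the opposite sign to the other two, and as \<open>- c - c = c\<close> modulo 3, the list
  \<open>a, b, - c, - c\<close> is a zero-sum quadruple with the same nonzero sum of
  exponents.\<close>

lemma bad_imp:
  assumes "a + b + c = 0" "bad a b c"
  shows "both a" "both b" "both c" "\<not> (P a \<and> P b \<and> P c)" "\<not> (P (- a) \<and> P (- b) \<and> P (- c))"
proof -
  have "L (- a) + L (- b) + L (- c) = - (L a + L b + L c)" "- a + - b + - c = - (a + b + c)"
    by (simp_all add: L_uminus)
  then have neg0: "- a + - b + - c = 0" and negL: "L (- a) + L (- b) + L (- c) \<noteq> 0"
    using assms by (simp_all only: bad_def neg_equal_0_iff_equal not_False_eq_True)
  then show n: "\<not> (P a \<and> P b \<and> P c)" "\<not> (P (- a) \<and> P (- b) \<and> P (- c))"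
    using triple[of a b c] triple[of "- a" "- b" "- c"] assms by (auto simp: bad_def)
  have *: "both a' \<and> both b' \<and> both c'"
    if "L a' + L b' + L c' \<noteq> 0" "a' + b' + c' = 0" "P a'" "P b'" "P (- c')" for a' b' c'
  proof -
    have "(- c') + (- c') = c'"
      using three_times_3[of "fst c'"] three_times_3[of "snd c'"]
      by (auto simp: prod_eq_iff algebra_simps eq_neg_iff_add_eq_0)
    moreover have "- L c' + - L c' = L c'"
      using three_times_3[of "L c'"] by (simp add: algebra_simps eq_neg_iff_add_eq_0)
    ultimately have "a' + b' + - c' + - c' = 0" "L a' + L b' + L (- c') + L (- c') \<noteq> 0"
      using that(1,2) by (simp_all only: add.assoc L_uminus not_False_eq_True)
    then show ?thesis
      using quadruple[of a' b' "- c'"] that(3-5) by (simp add: both_def)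
  qed
  have neg: "both (- a') = both a'" for a'
    by (auto simp: both_def)
  have "both a \<and> both b \<and> both c"
  proof -
    have nz: "L a + L b + L c \<noteq> 0" "present a" "present b" "present c"
      using assms(2) by (auto simp: bad_def)
    consider "P a" "P b" "P (- c)" | "P a" "P c" "P (- b)" | "P b" "P c" "P (- a)"
      | "P (- a)" "P (- b)" "P c" | "P (- a)" "P (- c)" "P b" | "P (- b)" "P (- c)" "P a"
      using nz n unfolding present_def by blast
    then show ?thesis
    proof cases
      case 1 then show ?thesis using *[of a b c] nz assms(1) by auto
    next
      case 2 then show ?thesis using *[of a c b] nz assms(1) by (auto simp: ac_simps)
    next
      case 3 then show ?thesis using *[of b c a] nz assms(1) by (auto simp: ac_simps)
    next
      case 4 then show ?thesis using *[of "- a" "- b" "- c"] neg0 negL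
        by (auto simp: neg)
    next
      case 5 then show ?thesis using *[of "- a" "- c" "- b"] neg0 negL
        by (auto simp: neg ac_simps)
    next
      case 6 then show ?thesis using *[of "- b" "- c" "- a"] neg0 negL
        by (auto simp: neg ac_simps)
    qed
  qed
  then show "both a" "both b" "both c"
    by auto
qed

text \<open>F_3^2 has four lines through 0, and any three of them carry exactly one zero-sum triple
  up to a global sign. The hypotheses run through these four triples. Two lines that occur fix a
  linear function, and the triples force the remaining values.\<close>

lemma linear_if_no_bad:
  assumes "\<not> bad (1, 0) (1, 1) (1, 2)" "\<not> bad (1, 0) (0, 1) (2, 2)"
    "\<not> bad (1, 0) (0, 2) (2, 1)" "\<not> bad (0, 1) (1, 1) (2, 1)"
  shows "\<exists>u. \<forall>a. P a \<longrightarrow> L a = pairing a u"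
proof -
  define X Y A B where defs: "X = L (1, 0)" "Y = L (0, 1)" "A = L (1, 1)" "B = L (2, 1)"
  define x y a b where "x = present (1, 0)" "y = present (0, 1)" "a = present (1, 1)" "b = present (2, 1)"
  note pdefs = this
  have pr: "present (2, 2) = a" "present (1, 2) = b" "present (0, 2) = y"
    by (auto simp: pdefs present_def)
  have h: "x \<Longrightarrow> a \<Longrightarrow> b \<Longrightarrow> B = X + A" "x \<Longrightarrow> y \<Longrightarrow> a \<Longrightarrow> A = X + Y"
    "x \<Longrightarrow> y \<Longrightarrow> b \<Longrightarrow> B = Y - X" "y \<Longrightarrow> a \<Longrightarrow> b \<Longrightarrow> B = - Y - A"
    using assms unfolding bad_def pr L_12 L_22 L_02 defs[symmetric] pdefs[symmetric]
    by (auto simp: algebra_simps eq_neg_iff_add_eq_0)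
  have double: "r + r = - r" for r :: 3
    using three_times_3[of r] by (simp add: eq_neg_iff_add_eq_0)
  have "\<exists>s t. (x \<longrightarrow> X = s) \<and> (y \<longrightarrow> Y = t) \<and> (a \<longrightarrow> A = s + t) \<and> (b \<longrightarrow> B = t - s)"
  proof -
    consider x y | x "\<not> y" a | x "\<not> y" "\<not> a" | "\<not> x" y a | "\<not> x" y "\<not> a" | "\<not> x" "\<not> y"
      by blast
    then show ?thesis
    proof cases
      case 1
      then show ?thesis using h(2,3) by (intro exI[of _ X] exI[of _ Y]) blast
    next
      case 2
      then show ?thesis using h(1) double[of X] by (intro exI[of _ X] exI[of _ "A - X"]) (simp add: diff_diff_eq)
    next
      case 3
      then show ?thesis by (intro exI[of _ X] exI[of _ "B + X"]) auto
    next
      case 4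
      then show ?thesis using h(4) double[of Y] by (intro exI[of _ "A - Y"] exI[of _ Y]) (simp add: diff_diff_eq2)
    next
      case 5
      then show ?thesis by (intro exI[of _ "Y - B"] exI[of _ Y]) auto
    next
      case 6
      \<comment> \<open>Solving \<open>s + t = A\<close> and \<open>t - s = B\<close> requires
        division by 2, which is multiplication by -1 modulo 3.\<close>
      have "A = (B - A) + (- A - B)" "B = (- A - B) - (B - A)"
        using double[of A] double[of B] by (simp_all add: algebra_simps eq_neg_iff_add_eq_0)
      then show ?thesis using 6 by (intro exI[of _ "B - A"] exI[of _ "- A - B"]) simp
    qed
  qed
  then obtain s t where st: "x \<longrightarrow> X = s" "y \<longrightarrow> Y = t" "a \<longrightarrow> A = s + t" "b \<longrightarrow> B = t - s"
    by blast
  have "L c = pairing c (s, t)" if "P c" for c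
  proof -
    have "2 * s = - s" "2 * t = - t"
      using double[of s] double[of t] by (simp_all only: mult_2)
    then have "pairing (1, 0) (s, t) = s" "pairing (2, 0) (s, t) = - s" "pairing (0, 1) (s, t) = t"
      "pairing (0, 2) (s, t) = - t" "pairing (1, 1) (s, t) = s + t" "pairing (2, 2) (s, t) = - s - t"
      "pairing (2, 1) (s, t) = t - s" "pairing (1, 2) (s, t) = s - t" "pairing (0, 0) (s, t) = 0"
      by (simp_all add: pairing_def)
    moreover have "x" if "c = (1, 0) \<or> c = (2, 0)"
      using that \<open>P c\<close> by (auto simp: pdefs present_def)
    moreover have "y" if "c = (0, 1) \<or> c = (0, 2)"
      using that \<open>P c\<close> by (auto simp: pdefs present_def)
    moreover have "a" if "c = (1, 1) \<or> c = (2, 2)"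
      using that \<open>P c\<close> by (auto simp: pdefs present_def)
    moreover have "b" if "c = (2, 1) \<or> c = (1, 2)"
      using that \<open>P c\<close> by (auto simp: pdefs present_def)
    moreover obtain i j where c: "c = (i, j)"
      by (cases c)
    ultimately show ?thesis
      using st cases_3[of i] cases_3[of j] unfolding c defs
      by (elim disjE) (simp_all add: L_00 L_22 L_12 L_20 L_02)
  qed
  then show ?thesis by blast
qed

text \<open>Four bad triples reduce to two patterns. A bad triple through \<open>(1, 0)\<close>
  forces both signs of that weight, and then always spoils additivity on the lines of
  \<open>(1, 0)\<close>, \<open>(1, 1)\<close>, \<open>(1, 2)\<close>. The parameter
  \<open>e\<close> absorbs the global sign.\<close>

lemma linear_or_obstructed:
  obtains (linear) u where "\<And>a. P a \<Longrightarrow> L a = pairing a u"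
  | (rotated) e where "e \<noteq> 0" "P (e, 0)" "P (- e, 0)" "P (e, e)" "P (- e, e)"
      "L (e, 0) + L (e, e) - L (- e, e) \<noteq> 0"
  | (mixed) e where "e \<noteq> 0" "P (e, e)" "P (- e, e)" "P (0, - e)" 
      "L (e, e) + L (- e, e) + L (0, e) \<noteq> 0"
proof -
  have rot: thesis
    if "P (1,0)" "P (2,0)" "L (1, 0) + L (1, 1) - L (2, 1) \<noteq> 0" "P (1,1) \<and> P (2,1) \<or> P (1,2) \<and> P (2,2)"
    using that(4)
  proof
    assume "P (1,1) \<and> P (2,1)"
    then show thesis using rotated[of 1] that by simp
  next
    assume "P (1,2) \<and> P (2,2)"
    moreover have "L (2, 0) + L (2, 2) - L (1, 2) = - (L (1, 0) + L (1, 1) - L (2, 1))"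
      by (simp add: L_20 L_22 L_12)
    then have "L (2, 0) + L (2, 2) - L (1, 2) \<noteq> 0"
      using that(3) by (simp only: neg_equal_0_iff_equal not_False_eq_True)
    ultimately show thesis using rotated[of 2] that(1,2) by simp
  qed
  consider "bad (1, 0) (1, 1) (1, 2)" | "bad (1, 0) (0, 1) (2, 2)"
    | "bad (1, 0) (0, 2) (2, 1)" | "bad (0, 1) (1, 1) (2, 1)" | "\<exists>u. \<forall>a. P a \<longrightarrow> L a = pairing a u"
    using linear_if_no_bad by blast
  then show thesis
  proof cases
    case 1
    have "L (1, 0) + L (1, 1) - L (2, 1) \<noteq> 0"
      using 1 by (simp add: bad_def L_12)
    then show ?thesis
      using bad_imp[OF _ 1] by (intro rot) (auto simp: both_def)
  next
    case 2
    have b: "P (1,0)" "P (2,0)" "P (0,1) \<or> P (0,2)" "P (1,1) \<and> P (2,1) \<and> P (0,1) \<or> P (1,2) \<and> P (2,2) \<and> P (0,2)"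
      using bad_imp[OF _ 2] by (auto simp: both_def)
    \<comment> \<open>By the last part of \<open>b\<close> these three weights, or their negatives,
      all occur with matching signs, so additivity holds here. This trades \<open>(0, 1)\<close> for
      \<open>(2, 1)\<close> in the bad triple.\<close>
    have "L (1,1) + L (2,1) + L (0,1) = 0"
      using b(4) triple[of "(1,1)" "(2,1)" "(0,1)"] triple[of "(2,2)" "(1,2)" "(0,2)"]
        cases_3[of "L (1,1)"] cases_3[of "L (2,1)"] cases_3[of "L (0,1)"]
      by (auto simp: L_22 L_12 L_02)
    moreover have "L (1,0) + L (0,1) - L (1,1) \<noteq> 0"
      using 2 by (simp add: bad_def L_22)
    ultimately have "L (1, 0) + L (1, 1) - L (2, 1) \<noteq> 0"
      using cases_3[of "L (1,0)"] cases_3[of "L (1,1)"] cases_3[of "L (2,1)"] by (auto simp: add_eq_0_iff)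
    then show ?thesis
      using b by (intro rot) auto
  next
    case 3
    have b: "P (1,0)" "P (2,0)" "P (0,1) \<or> P (0,2)" "P (1,1) \<and> P (2,1) \<and> P (0,1) \<or> P (1,2) \<and> P (2,2) \<and> P (0,2)"
      using bad_imp[OF _ 3] by (auto simp: both_def)
    have "L (1,1) + L (2,1) + L (0,1) = 0"
      using b(4) triple[of "(1,1)" "(2,1)" "(0,1)"] triple[of "(2,2)" "(1,2)" "(0,2)"]
        cases_3[of "L (1,1)"] cases_3[of "L (2,1)"] cases_3[of "L (0,1)"]
      by (auto simp: L_22 L_12 L_02)
    moreover have "L (1,0) - L (0,1) + L (2,1) \<noteq> 0"
      using 3 by (simp add: bad_def L_02)
    ultimately have "L (1, 0) + L (1, 1) - L (2, 1) \<noteq> 0"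
      using cases_3[of "L (1,0)"] cases_3[of "L (1,1)"] cases_3[of "L (2,1)"] by (auto simp: add_eq_0_iff)
    then show ?thesis
      using b by (intro rot) auto
  next
    case 4
    have n: "L (1,1) + L (2,1) + L (0,1) \<noteq> 0"
      using 4 by (simp add: bad_def ac_simps)
    have "P (1,1) \<and> P (2,1) \<and> P (0,2) \<or> P (1,2) \<and> P (2,2) \<and> P (0,1)"
      using bad_imp[OF _ 4] by (auto simp: both_def)
    then show ?thesis
    proof
      assume "P (1,1) \<and> P (2,1) \<and> P (0,2)"
      then show thesis using mixed[of 1] n by simp
    next
      assume *: "P (1,2) \<and> P (2,2) \<and> P (0,1)"
      have "L (2,2) + L (1,2) + L (0,2) \<noteq> 0"
        using n cases_3[of "L (1,1)"] cases_3[of "L (2,1)"] cases_3[of "L (0,1)"] by (auto simp: L_22 L_12 L_02)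
      then show thesis using mixed[of 2] * by simp
    qed
  next
    case 5
    then show ?thesis using linear by blast
  qed
qed

end

section \<open>Weight components of two points\<close>

text \<open>
  \<open>T\<close> is the action of a transposition; it exchanges \<open>v\<close> with \<open>v'\<close> and \<open>w\<close> with \<open>w'\<close>.
\<close>

locale swapped_weight_vectors =
  fixes \<omega> :: "'k::field" and T :: "('i \<Rightarrow> 'k) \<Rightarrow> 'i \<Rightarrow> 'k"
    and v v' w w' :: "3 \<times> 3 \<Rightarrow> 'i \<Rightarrow> 'k"
  assumes two: "(2 :: 'k) \<noteq> 0" and \<omega>3: "\<omega> ^ 3 = 1" and \<omega>1: "\<omega> \<noteq> 1"
    and T_smul: "T (smul c f) = smul c (T f)"
    and T_v: "T (v a) = v' (flip a)" and T_v': "T (v' a) = v (flip a)"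
    and T_w: "T (w a) = w' (flip a)"
    and moments: "length l \<le> 6 \<Longrightarrow> weight l = 0 \<Longrightarrow> mon v l + mon v' l = mon w l + mon w' l"
    and agree: "length l \<le> 3 \<Longrightarrow> weight l = 0 \<Longrightarrow> mon v l = mon w l"
begin

abbreviation P :: "3 \<times> 3 \<Rightarrow> bool" where
  "P a \<equiv> v a \<noteq> zerofun"

abbreviation z :: "3 \<Rightarrow> 'k" where
  "z \<equiv> cpow \<omega>"

lemmas z_add = cpow_add[OF \<omega>3]
lemmas z_nonzero = cpow_nonzero[OF \<omega>3]
lemmas z_eq_1 = cpow_eq_1_iff[OF \<omega>3 \<omega>1]

lemma z_uminus: "z (- i) = 1 / z i"
  using z_add[of i "- i"] z_nonzero[of i] by (simp add: field_simps)

text \<open>Three copies of a weight sum to 0, so all cubic products of coordinates of one component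
  are invariants of degree 3.\<close>

lemma ex_exponent: "\<exists>k. w a = smul (z k) (v a)"
proof -
  have "a + a + a = 0"
    using three_times_3[of "fst a"] three_times_3[of "snd a"] by (simp add: prod_eq_iff)
  then have "v a i * v a j * v a k = w a i * w a j * w a k" for i j k
    using agree[of "[(a, i), (a, j), (a, k)]"] by (simp add: add.assoc mult.assoc)
  then obtain c where "c ^ 3 = 1" "w a = smul c (v a)"
    using cubes_eq_imp_smul by metis
  then show ?thesis
    using cube_root_cases[OF \<omega>3 \<omega>1] by metis
qed

definition expo :: "3 \<times> 3 \<Rightarrow> 3" where
  "expo a = (SOME k. w a = smul (z k) (v a))"

lemma expo: "w a = smul (z (expo a)) (v a)"
  unfolding expo_def by (rule someI_ex) (rule ex_exponent)

text \<open>\<open>expo a\<close> is arbitrary where \<open>v a\<close> vanishes. There the value is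
  borrowed from \<open>- a\<close>, or set to 0, so that \<open>L\<close> is odd on all weights and
  not only on those that occur.\<close>

definition L :: "3 \<times> 3 \<Rightarrow> 3" where
  "L a = (if P a then expo a else if P (- a) then - expo (- a) else 0)"

lemma w_eq: "w a = smul (z (L a)) (v a)"
  using expo[of a] by (auto simp: L_def)

lemma L_uminus: "L (- a) = - L a"
proof (cases "P a \<and> P (- a)")
  case True
  then obtain i j where ij: "v a i \<noteq> 0" "v (- a) j \<noteq> 0"
    by (metis nonzero_funE)
  have "v a i * v (- a) j = w a i * w (- a) j"
    using agree[of "[(a, i), (- a, j)]"] by simp
  also have "\<dots> = z (L a + L (- a)) * (v a i * v (- a) j)"
    by (subst (1 2) w_eq) (simp add: smul_def z_add)
  finally have "L a + L (- a) = 0"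
    using ij z_eq_1[of "L a + L (- a)"] by simp
  then show ?thesis
    by (simp add: eq_neg_iff_add_eq_0 add.commute)
qed (auto simp: L_def)

lemma w'_eq: "w' a = smul (z (L (flip a))) (v' a)"
proof -
  have "w' a = T (w (flip a))"
    by (simp add: T_w)
  then show ?thesis
    by (simp add: w_eq T_smul T_v)
qed

lemma T_zero: "T zerofun = zerofun"
  using T_smul[of 0 zerofun] by simp

lemma v'_zero_iff: "v' a = zerofun \<longleftrightarrow> v (flip a) = zerofun"
  using T_zero T_v[of "flip a"] T_v'[of a] by (metis flip_flip)

lemma w_app: "w a i = z (L a) * v a i"
  using fun_cong[OF w_eq, of a i] by (simp add: smul_def)

lemma w'_app: "w' a i = z (L (flip a)) * v' a i"
  using fun_cong[OF w'_eq, of a i] by (simp add: smul_def)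

lemma mon_scaled:
  assumes "\<And>a i. f a i = z (k a) * g a i"
  shows "mon f l = z (\<Sum>a\<leftarrow>map fst l. k a) * mon g l"
proof (induction l)
  case (Cons p l)
  then show ?case
    by (cases p) (simp add: assms z_add)
qed simp

lemma mon_w: "mon w l = z (\<Sum>a\<leftarrow>map fst l. L a) * mon v l"
  by (rule mon_scaled) (rule w_app)

lemma mon_w': "mon w' l = z (\<Sum>a\<leftarrow>map fst l. L (flip a)) * mon v' l"
  by (rule mon_scaled) (rule w'_app)

text \<open>After cancelling the nonzero factor \<open>1 - z s\<close>, equal sums \<open>s\<close>
  of exponents give \<open>mon v' l = - mon v l\<close>, and opposite sums give
  \<open>mon v' l = z s * mon v l\<close>. The first case is used in \<open>no_mixed\<close>, the
  second in \<open>rotated\<close>.\<close>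

lemma twisted_moments:
  assumes "length l \<le> 6" "weight l = 0"
  shows "mon v l * (1 - z (\<Sum>a\<leftarrow>map fst l. L a)) = mon v' l * (z (\<Sum>a\<leftarrow>map fst l. L (flip a)) - 1)"
  using moments[OF assms] unfolding mon_w mon_w' by (simp add: algebra_simps)

lemma mon_v'_eq:
  assumes "length l \<le> 6" "weight l = 0" "(\<Sum>a\<leftarrow>map fst l. L a) = s" "(\<Sum>a\<leftarrow>map fst l. L (flip a)) = - s" "s \<noteq> 0"
  shows "mon v' l = z s * mon v l"
proof -
  have "mon v l * (1 - z s) = mon v' l * (1 / z s - 1)"
    using twisted_moments[OF assms(1,2)] unfolding assms(3,4) z_uminus .
  then have "(1 - z s) * (z s * mon v l) = (1 - z s) * mon v' l"
    using z_nonzero[of s] by (simp add: field_simps)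
  then show ?thesis
    using assms(5) z_eq_1[of s] by simp
qed

lemma triple:
  assumes "a + b + c = 0" "P a" "P b" "P c"
  shows "L a + L b + L c = 0"
proof -
  obtain i j k where ijk: "v a i \<noteq> 0" "v b j \<noteq> 0" "v c k \<noteq> 0"
    using assms by (metis nonzero_funE)
  let ?l = "[(a, i), (b, j), (c, k)]"
  have "mon v ?l = z (L a + L b + L c) * mon v ?l"
    using agree[of ?l] mon_w[of ?l] assms(1) by (simp add: add.assoc)
  then show ?thesis
    using ijk z_eq_1[of "L a + L b + L c"] by simp
qed

lemma quadruple:
  assumes "a + b + c + c = 0" "P a" "P b" "P c" "L a + L b + L c + L c \<noteq> 0"
  shows "P (flip a) \<and> P (flip b) \<and> P (flip c)"
proof -
  obtain i j k where ijk: "v a i \<noteq> 0" "v b j \<noteq> 0" "v c k \<noteq> 0"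
    using assms by (metis nonzero_funE)
  let ?l = "[(a, i), (b, j), (c, k), (c, k)]"
  have "mon v ?l * (1 - z (L a + L b + L c + L c)) \<noteq> 0"
    using ijk assms(5) z_eq_1[of "L a + L b + L c + L c"] by simp
  then have "mon v' ?l \<noteq> 0"
    using twisted_moments[of ?l] assms(1) by (auto simp: add.assoc)
  then have "v' a \<noteq> zerofun" "v' b \<noteq> zerofun" "v' c \<noteq> zerofun"
    by auto
  then show ?thesis
    by (simp add: v'_zero_iff)
qed

section \<open>The two obstructed configurations\<close>

sublocale odd_exponents P L
  by unfold_locales (use L_uminus triple quadruple in auto)

text \<open>Applying \<open>T\<close> to the hypothesis exchanges \<open>v\<close> and
  \<open>v'\<close> and thereby inverts the scalar.\<close>

lemma v'_flip:
  assumes "v' a = smul c (v a)" "P (flip a)"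
  shows "c \<noteq> 0" "v' (flip a) = smul (1 / c) (v (flip a))"
proof -
  have *: "v (flip a) = smul c (v' (flip a))"
    using arg_cong[OF assms(1), of T] by (simp add: T_smul T_v T_v')
  show c: "c \<noteq> 0"
    using assms v'_zero_iff[of a] by auto
  show "v' (flip a) = smul (1 / c) (v (flip a))"
    using c by (subst *) (simp add: smul_smul)
qed

text \<open>
  The monomial of weights \<open>(e, e), (-e, e), (0, -e), (0, -e)\<close> changes sign from \<open>v\<close> to \<open>v'\<close>, although
  the scalars relating the components of \<open>v\<close> and \<open>v'\<close> multiply to 1 because \<open>T\<close> is an involution.
\<close>

lemma no_mixed:
  assumes e: "e \<noteq> 0" and P: "P (e, e)" "P (- e, e)" "P (0, - e)"
    and s: "L (e, e) + L (- e, e) + L (0, e) \<noteq> 0"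
  shows False
proof -
  obtain i j k where ijk: "v (e, e) i \<noteq> 0" "v (- e, e) j \<noteq> 0" "v (0, - e) k \<noteq> 0"
    using P by (metis nonzero_funE)
  define s where "s = L (e, e) + L (- e, e) + L (0, e)"
  have Ly: "L (0, - e) = - L (0, e)"
    using L_neg[of 0 e] by simp
  have y2: "- L (0, e) - L (0, e) = L (0, e)"
    using three_times_3[of "L (0, e)"] by (simp add: algebra_simps eq_neg_iff_add_eq_0)
  have eq: "v' (e, e) a * v' (- e, e) b * (v' (0, - e) c * v' (0, - e) d)
      = - (v (e, e) a * v (- e, e) b * (v (0, - e) c * v (0, - e) d))" for a b c d
  proof -
    let ?l = "[((e, e), a), ((- e, e), b), ((0, - e), c), ((0, - e), d)]"
    \<comment> \<open>\<open>flip\<close> exchanges the first two weights and fixes the third, so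
      both sums agree; the doubled weight contributes
      \<open>- 2 * L (0, e) = L (0, e)\<close>.\<close>
    have "(\<Sum>a\<leftarrow>map fst ?l. L a) = s" "(\<Sum>a\<leftarrow>map fst ?l. L (flip a)) = s"
      using y2 by (simp_all add: s_def Ly algebra_simps)
    then have "mon v ?l * (1 - z s) = mon v' ?l * (z s - 1)"
      using twisted_moments[of ?l] by simp
    moreover have "(1 - r) * (A + B) = 0" if "A * (1 - r) = B * (r - 1)" for r A B :: 'k
    proof -
      have "(1 - r) * (A + B) = A * (1 - r) - B * (r - 1)"
        by (simp add: algebra_simps)
      then show ?thesis
        using that by simp
    qed
    ultimately have "(1 - z s) * (mon v ?l + mon v' ?l) = 0"
      by blast
    then have "mon v ?l + mon v' ?l = 0"
      using s z_eq_1[of s] by (simp add: s_def)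
    then show ?thesis
      by (simp add: eq_neg_iff_add_eq_0 mult.assoc add.commute)
  qed
  obtain c where c: "v' (e, e) = smul c (v (e, e))"
  proof (rule proportional)
    show "v' (e, e) a * (v' (- e, e) j * (v' (0, - e) k * v' (0, - e) k))
      = v (e, e) a * (- (v (- e, e) j * (v (0, - e) k * v (0, - e) k)))" for a
      using eq[of a j k k] by (simp add: mult_ac)
  qed (use P ijk in auto)
  obtain d where d: "v' (0, - e) = smul d (v (0, - e))"
  proof (rule proportional)
    show "v' (0, - e) a * (v' (e, e) i * (v' (- e, e) j * v' (0, - e) k))
      = v (0, - e) a * (- (v (e, e) i * (v (- e, e) j * v (0, - e) k)))" for a
      using eq[of i j a k] by (simp add: mult_ac)
  qed (use P ijk in auto)
  have c': "c \<noteq> 0" "v' (- e, e) = smul (1 / c) (v (- e, e))"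
    using v'_flip[OF c] P by simp_all
  \<comment> \<open>As \<open>flip\<close> fixes \<open>(0, - e)\<close>, the scalar
    \<open>d\<close> is its own inverse.\<close>
  have "d \<noteq> 0" "v' (0, - e) = smul (1 / d) (v (0, - e))"
    using v'_flip[OF d] P by simp_all
  then have "d * d = 1"
    using d ijk(3) by (auto simp: smul_def fun_eq_iff field_simps)
  moreover have "(d * d) * (v (e, e) i * v (- e, e) j * (v (0, - e) k * v (0, - e) k))
      = - (v (e, e) i * v (- e, e) j * (v (0, - e) k * v (0, - e) k))"
    using eq[of i j k k] c'(1) unfolding c c'(2) d by (simp add: smul_def mult_ac)
  ultimately have "v (e, e) i * v (- e, e) j * (v (0, - e) k * v (0, - e) k)
      = - (v (e, e) i * v (- e, e) j * (v (0, - e) k * v (0, - e) k))"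
    by (simp only: mult_1_left)
  then have "2 * (v (e, e) i * v (- e, e) j * (v (0, - e) k * v (0, - e) k)) = 0"
    unfolding mult_2 by (simp add: eq_neg_iff_add_eq_0)
  then show False
    using two ijk by simp
qed

text \<open>
  Here \<open>w\<close> is not conjugate to \<open>v\<close> under \<open>C\<^sub>3 \<times> C\<^sub>3\<close>, but it is conjugate to \<open>v'\<close>: monomials of degree
  4, 5 and 6 force every component of \<open>v'\<close> to be a cube root of unity times that of \<open>v\<close>.
\<close>

lemma rotated:
  assumes e: "e \<noteq> 0" and P: "P (e, 0)" "P (- e, 0)" "P (e, e)" "P (- e, e)"
    and s: "L (e, 0) + L (e, e) - L (- e, e) \<noteq> 0"
  shows "\<exists>u. \<forall>a. w a = smul (z (pairing a u)) (v' a)"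
proof -
  define s where "s = L (e, 0) + L (e, e) - L (- e, e)"
  have s0: "s \<noteq> 0"
    using s by (simp add: s_def)
  have thrice: "a + (a + b) = b - a" for a b :: 3
    using three_times_3[of a] by (simp add: eq_diff_eq ac_simps)
  have twice: "a + a = - a" for a :: 3
    using thrice[of a 0] by simp
  have Lneg: "L (- e, 0) = - L (e, 0)" "L (- e, - e) = - L (e, e)" "L (e, - e) = - L (- e, e)" "L (0, - e) = - L (0, e)"
    using L_neg[of e 0] L_neg[of e e] L_neg[of "- e" e] L_neg[of 0 e] by simp_all
  have ee: "e + (e + e) = 0"
    using three_times_3[of e] by (simp add: add.assoc)
  \<comment> \<open>Each of the first two weights would complete a zero-sum triple whose exponents
    add up to \<open>- s\<close> or \<open>s\<close>. The third would complete two triples, and the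
    difference of their exponent sums is \<open>- s\<close>.\<close>
  have absent: "\<not> P (- e, - e)" "\<not> P (e, - e)" "\<not> P (0, - e)"
  proof -
    have plus_s: "L (e, 0) + L (e, e) + L (e, - e) = s"
      by (simp add: Lneg s_def)
    have minus_s: "L (- e, 0) + L (- e, - e) + L (- e, e) = - s"
      by (simp add: Lneg s_def)
    show "\<not> P (- e, - e)"
      using triple[of "(- e, 0)" "(- e, - e)" "(- e, e)"] P s0 three_times_3[of "- e"] minus_s
      by auto
    show "\<not> P (e, - e)"
      using triple[of "(e, 0)" "(e, e)" "(e, - e)"] P s0 three_times_3[of e] plus_s
      by auto
    show "\<not> P (0, - e)"
    proof
      assume "P (0, - e)"
      then have "L (e, 0) + L (- e, e) - L (0, e) = 0" "- L (e, 0) + L (e, e) - L (0, e) = 0"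
        using triple[of "(e, 0)" "(- e, e)" "(0, - e)"] triple[of "(- e, 0)" "(e, e)" "(0, - e)"] P
        by (auto simp: Lneg)
      then have "L (e, 0) + L (e, 0) + L (- e, e) - L (e, e) = 0"
        by (simp add: algebra_simps)
      moreover have "L (e, 0) + L (e, 0) + L (- e, e) - L (e, e) = - s"
        by (simp add: twice s_def)
      ultimately show False
        using s0 by (simp only: neg_equal_0_iff_equal)
    qed
  qed
  obtain i j k h where nz: "v (e, 0) h \<noteq> 0" "v (- e, 0) i \<noteq> 0" "v (e, e) j \<noteq> 0" "v (- e, e) k \<noteq> 0"
    using P by (metis nonzero_funE)
  \<comment> \<open>Each list is chosen with weight 0 and exponent sum \<open>s\<close>, while its
    flip has sum \<open>- s\<close>, as \<open>mon_v'_eq\<close> requires.\<close>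
  have eq1: "v' (e, e) a * (v' (- e, e) b * (v' (- e, e) c * v' (e, 0) d))
    = z s * (v (e, e) a * (v (- e, e) b * (v (- e, e) c * v (e, 0) d)))" for a b c d
    using mon_v'_eq[of "[((e, e), a), ((- e, e), b), ((- e, e), c), ((e, 0), d)]" s] s0
    by (simp add: s_def Lneg thrice ee algebra_simps)
  have eq2: "v' (e, e) a * (v' (- e, e) b * (v' (- e, e) c * (v' (- e, 0) d * v' (- e, 0) f)))
    = z s * (v (e, e) a * (v (- e, e) b * (v (- e, e) c * (v (- e, 0) d * v (- e, 0) f))))" for a b c d f
    using mon_v'_eq[of "[((e, e), a), ((- e, e), b), ((- e, e), c), ((- e, 0), d), ((- e, 0), f)]" s] s0
    by (simp add: s_def Lneg thrice twice ee algebra_simps)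
  have eq3: "v' 0 f * (v' (e, e) a * (v' (- e, e) b * (v' (- e, e) c * v' (e, 0) d)))
    = z s * (v 0 f * (v (e, e) a * (v (- e, e) b * (v (- e, e) c * v (e, 0) d))))" for a b c d f
    using mon_v'_eq[of "[(0, f), ((e, e), a), ((- e, e), b), ((- e, e), c), ((e, 0), d)]" s] s0
    by (simp add: s_def Lneg thrice ee L_00[folded zero_prod_def] algebra_simps)
  obtain c where c: "v' (e, e) = smul c (v (e, e))"
  proof (rule proportional)
    show "v' (e, e) a * (v' (- e, e) k * (v' (- e, e) k * v' (e, 0) h))
      = v (e, e) a * (z s * (v (- e, e) k * (v (- e, e) k * v (e, 0) h)))" for a
      using eq1[of a k k h] by (simp add: mult_ac)
  qed (use P nz z_nonzero in auto)
  obtain d where d: "v' (e, 0) = smul d (v (e, 0))"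
  proof (rule proportional)
    show "v' (e, 0) a * (v' (e, e) j * (v' (- e, e) k * v' (- e, e) k))
      = v (e, 0) a * (z s * (v (e, e) j * (v (- e, e) k * v (- e, e) k)))" for a
      using eq1[of j k k a] by (simp add: mult_ac)
  qed (use P nz z_nonzero in auto)
  have c': "c \<noteq> 0" "v' (- e, e) = smul (1 / c) (v (- e, e))"
    using v'_flip[OF c] P by simp_all
  have d': "d \<noteq> 0" "v' (- e, 0) = smul (1 / d) (v (- e, 0))"
    using v'_flip[OF d] P by simp_all
  have dc: "d = z s * c"
    using eq1[of j k k h] nz c' d' unfolding c c'(2) d by (simp add: smul_def field_simps)
  \<comment> \<open>\<open>eq1\<close> only ties \<open>d\<close> to \<open>c\<close>. The monomial
    of degree 5 in \<open>eq2\<close> then makes \<open>d\<close> a cube root of unity, because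
    \<open>z s * c = d\<close>.\<close>
  have "1 = z s * c * (d * d)"
    using eq2[of j k k i i] nz c' d' unfolding c c'(2) d'(2) by (simp add: smul_def field_simps)
  then have d3: "d ^ 3 = 1"
    by (simp add: dc power3_eq_cube mult_ac)
  then obtain t where t: "d = z t"
    using cube_root_cases[OF \<omega>3 \<omega>1] by blast
  have zc: "c = z (t - s)"
    using dc z_nonzero[of s] z_add[of "t - s" s] by (simp add: t mult_ac)
  have v'0: "v' 0 = v 0"
  proof
    fix f
    have M: "v (e, e) j * (v (- e, e) k * (v (- e, e) k * v (e, 0) h)) \<noteq> 0"
      using nz by simp
    have "z s * (v (e, e) j * (v (- e, e) k * (v (- e, e) k * v (e, 0) h))) * v' 0 f
      = z s * (v (e, e) j * (v (- e, e) k * (v (- e, e) k * v (e, 0) h))) * v 0 f"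
      using eq3[of f j k k h] unfolding eq1 by (simp only: mult_ac)
    then show "v' 0 f = v 0 f"
      using M z_nonzero[of s] by simp
  qed
  have v'y: "v' (0, e) = v (0, e) \<and> L (0, e) = - L (e, e) - L (- e, e)" if y: "P (0, e)"
  proof
    have Ls: "L (e, e) + L (- e, e) + L (0, e) = 0"
      using triple[of "(e, e)" "(- e, e)" "(0, e)"] P y by (simp add: ee add.assoc)
    then show Ly: "L (0, e) = - L (e, e) - L (- e, e)"
      using minus_unique[OF Ls] by simp
    show "v' (0, e) = v (0, e)"
    proof
      fix f
      have "v' (e, e) j * (v' (e, e) j * (v' (e, 0) h * v' (0, e) f))
          = z s * (v (e, e) j * (v (e, e) j * (v (e, 0) h * v (0, e) f)))"
        using mon_v'_eq[of "[((e, e), j), ((e, e), j), ((e, 0), h), ((0, e), f)]" s] s0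
        by (simp add: s_def Lneg Ly thrice twice ee algebra_simps)
      then have E: "c * c * d * v' (0, e) f = z s * v (0, e) f"
        using nz unfolding c d by (simp add: smul_def mult_ac)
      \<comment> \<open>Together with \<open>d = z s * c\<close> and \<open>d ^ 3 = 1\<close> this
        gives \<open>c * c * d = z s\<close>, so the factors in \<open>E\<close> cancel.\<close>
      have "z s * z s * z s = 1"
        using three_times_3[of s] by (simp add: z_add[symmetric])
      moreover have "z s * z s * (c * c * d) = d ^ 3"
        by (simp add: dc power3_eq_cube mult_ac)
      ultimately have "v' (0, e) f = (z s * z s * (c * c * d)) * v' (0, e) f"
        "(z s * z s * z s) * v (0, e) f = v (0, e) f"
        using d3 by simp_all
      then show "v' (0, e) f = v (0, e) f"
        by (metis E mult.assoc)
    qed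
  qed
  define p q x where pqx: "p = L (e, e)" "q = L (- e, e)" "x = L (e, 0)"
  \<comment> \<open>The two entries are read off at \<open>(e, 0)\<close> and \<open>(0, e)\<close>,
    where \<open>w\<close> is \<open>z (x - t)\<close> and \<open>z (- p - q)\<close> times
    \<open>v'\<close>; since \<open>e * e = 1\<close>, the factor \<open>e\<close> undoes the one in
    the pairing.\<close>
  define u where "u = (e * (x - t), - e * (p + q))"
  have e2: "e * (e * a) = a" for a
    using square_3[OF e] by (simp add: mult.assoc[symmetric])
  have sx: "s = x + p - q"
    by (simp add: s_def pqx)
  have rel: "w a = smul (z (L a - m)) (v' a)" if "v' a = smul (z m) (v a)" for a m
    unfolding that w_eq[of a] smul_smul z_add[symmetric] by simp
  have "w a = smul (z (pairing a u)) (v' a)" for a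
  proof -
    obtain a1 a2 where a: "a = (a1, a2)"
      by (cases a)
    have zero: "w b = smul y (v' b)" if "\<not> P b" "\<not> P (flip b)" for b y
      using that v'_zero_iff[of b] w_eq[of b] by simp
    have C: "w (e, e) = smul (z (p - (t - s))) (v' (e, e))"
      using rel[of "(e, e)" "t - s"] c zc by (simp add: pqx)
    have D: "w (- e, e) = smul (z (q + (t - s))) (v' (- e, e))"
      using rel[of "(- e, e)" "- (t - s)"] c'(2)[unfolded zc]
      by (simp only: z_uminus pqx diff_minus_eq_add)
    have X: "w (e, 0) = smul (z (x - t)) (v' (e, 0))"
      using rel[of "(e, 0)" t] d t by (simp add: pqx)
    have X': "w (- e, 0) = smul (z (t - x)) (v' (- e, 0))"
      using rel[of "(- e, 0)" "- t"] d' t unfolding z_uminus by (simp add: pqx Lneg)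
    have O: "w 0 = smul (z 0) (v' 0)"
      using rel[of 0 0] v'0 by (simp add: L_00[folded zero_prod_def])
    have Y: "w (0, e) = smul (z (- p - q)) (v' (0, e))"
    proof (cases "P (0, e)")
      case True
      then show ?thesis
        using rel[of "(0, e)" 0] v'y by (simp add: pqx)
    qed (use zero in simp)
    have pr: "pairing (e, e) u = p - (t - s)" "pairing (- e, e) u = q + (t - s)" "pairing (e, 0) u = x - t"
      "pairing (- e, 0) u = t - x" "pairing 0 u = 0" "pairing (0, e) u = - p - q"
      using twice[of p] twice[of q]
      by (simp_all add: pairing_def u_def e2 sx algebra_simps eq_neg_iff_add_eq_0)
    show ?thesis
      using cases_3_unit[OF e, of a1] cases_3_unit[OF e, of a2] C D X X' O Y absent zero[of "(- e, - e)"] zero[of "(e, - e)"] zero[of "(0, - e)"]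
      unfolding a by (elim disjE) (simp_all add: pr zero_prod_def[symmetric])
  qed
  then show ?thesis
    by blast
qed

lemma related:
  "(\<exists>u. \<forall>a. w a = smul (z (pairing a u)) (v a)) \<or> (\<exists>u. \<forall>a. w a = smul (z (pairing a u)) (v' a))"
proof (rule linear_or_obstructed)
  fix u
  assume u: "\<And>a. P a \<Longrightarrow> L a = pairing a u"
  have "w a = smul (z (pairing a u)) (v a)" for a
    using w_eq[of a] u[of a] by (cases "P a") simp_all
  then show ?thesis
    by blast
next
  fix e :: 3
  assume "e \<noteq> 0" "P (e, 0)" "P (- e, 0)" "P (e, e)" "P (- e, e)" "L (e, 0) + L (e, e) - L (- e, e) \<noteq> 0"
  then show ?thesis
    using rotated by blast
next
  fix e :: 3
  assume "e \<noteq> 0" "P (e, e)" "P (- e, e)" "P (0, - e)" "L (e, e) + L (- e, e) + L (0, e) \<noteq> 0"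
  then show ?thesis
    using no_mixed by blast
qed

end

section \<open>Polynomials\<close>

definition monomial_eval :: "(nat \<Rightarrow> 'r::comm_ring_1) \<Rightarrow> (nat \<Rightarrow>\<^sub>0 nat) \<Rightarrow> 'r" where
  "monomial_eval x m = (\<Prod>i \<in> Poly_Mapping.keys m. x i ^ Poly_Mapping.lookup m i)"

lemma monomial_eval_superset:
  assumes "finite A" "Poly_Mapping.keys m \<subseteq> A"
  shows "monomial_eval x m = (\<Prod>i\<in>A. x i ^ Poly_Mapping.lookup m i)"
  unfolding monomial_eval_def using assms
  by (intro prod.mono_neutral_left) (auto simp: in_keys_iff)

lemma monomial_eval_add: "monomial_eval x (m + m') = monomial_eval x m * monomial_eval x m'"
proof -
  let ?A = "Poly_Mapping.keys m \<union> Poly_Mapping.keys m'"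
  have "Poly_Mapping.keys (m + m') \<subseteq> ?A"
    by (rule keys_add)
  then show ?thesis
    by (simp add: monomial_eval_superset[of ?A] lookup_add power_add prod.distrib)
qed

lemma monomial_eval_0 [simp]: "monomial_eval x 0 = 1"
  by (simp add: monomial_eval_def)

lemma monomial_eval_single [simp]: "monomial_eval x (Poly_Mapping.single i k) = x i ^ k"
  by (simp add: monomial_eval_def)

definition mdegree :: "(nat \<Rightarrow>\<^sub>0 nat) \<Rightarrow> nat" where
  "mdegree m = (\<Sum>i \<in> Poly_Mapping.keys m. Poly_Mapping.lookup m i)"

lemma mdegree_superset:
  assumes "finite A" "Poly_Mapping.keys m \<subseteq> A"
  shows "mdegree m = (\<Sum>i\<in>A. Poly_Mapping.lookup m i)"
  unfolding mdegree_def using assms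
  by (intro sum.mono_neutral_left) (auto simp: in_keys_iff)

lemma mdegree_add: "mdegree (m + m') = mdegree m + mdegree m'"
proof -
  let ?A = "Poly_Mapping.keys m \<union> Poly_Mapping.keys m'"
  have "Poly_Mapping.keys (m + m') \<subseteq> ?A"
    by (rule keys_add)
  then show ?thesis
    by (simp add: mdegree_superset[of ?A] lookup_add sum.distrib)
qed

lemma total_degree_le_iff: "total_degree f \<le> d \<longleftrightarrow> (\<forall>m \<in> Poly_Mapping.keys f. mdegree m \<le> d)"
  by (simp add: total_degree_def mdegree_def)

lemma total_degree_mult: "total_degree (f * g) \<le> total_degree f + total_degree g"
  unfolding total_degree_le_iff
proof
  fix m assume "m \<in> Poly_Mapping.keys (f * g)"
  then obtain a b where "m = a + b" "a \<in> Poly_Mapping.keys f" "b \<in> Poly_Mapping.keys g"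
    using keys_mult[of f g] by blast
  then show "mdegree m \<le> total_degree f + total_degree g"
    using total_degree_le_iff[of f "total_degree f"] total_degree_le_iff[of g "total_degree g"]
    by (auto simp: mdegree_add intro!: add_mono)
qed

lemma total_degree_sum:
  assumes "\<And>a. a \<in> A \<Longrightarrow> total_degree (f a) \<le> d"
  shows "total_degree (\<Sum>a\<in>A. f a) \<le> d"
  using assms keys_sum[of f A] unfolding total_degree_le_iff by blast

lemma mpoly_ring_mult:
  assumes "f \<in> mpoly_ring n" "g \<in> mpoly_ring n"
  shows "f * g \<in> mpoly_ring n"
  unfolding mpoly_ring_def
proof (intro CollectI ballI)
  fix m assume "m \<in> Poly_Mapping.keys (f * g)"
  then obtain a b where "m = a + b" "a \<in> Poly_Mapping.keys f" "b \<in> Poly_Mapping.keys g"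
    using keys_mult[of f g] by blast
  then show "Poly_Mapping.keys m \<subseteq> {..<n}"
    using assms keys_add[of a b] unfolding mpoly_ring_def by blast
qed

lemma mpoly_ring_sum: "(\<And>a. a \<in> A \<Longrightarrow> f a \<in> mpoly_ring n) \<Longrightarrow> (\<Sum>a\<in>A. f a) \<in> mpoly_ring n"
  using keys_sum[of f A] unfolding mpoly_ring_def by blast

lemma mpoly_const_0 [simp]: "mpoly_const 0 = 0"
  and mpoly_const_1 [simp]: "mpoly_const 1 = 1"
  and mpoly_const_add: "mpoly_const (a + b) = mpoly_const a + mpoly_const b"
  and mpoly_const_mult: "mpoly_const (a * b) = mpoly_const a * mpoly_const b"
  by (simp_all add: mpoly_const_def single_add mult_single)

lemma mpoly_const_sum: "mpoly_const (\<Sum>a\<in>A. f a) = (\<Sum>a\<in>A. mpoly_const (f a))"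
  by (induction A rule: infinite_finite_induct) (simp_all add: mpoly_const_add)

lemma poly_mapping_sum_single:
  "f = (\<Sum>m\<in>Poly_Mapping.keys f. Poly_Mapping.single m (Poly_Mapping.lookup f m))"
proof (rule poly_mapping_eqI)
  fix m
  have "Poly_Mapping.lookup (\<Sum>m\<in>Poly_Mapping.keys f. Poly_Mapping.single m (Poly_Mapping.lookup f m)) m
      = (\<Sum>m'\<in>Poly_Mapping.keys f. if m' = m then Poly_Mapping.lookup f m' else 0)"
    by (simp add: lookup_sum lookup_single when_def)
  also have "\<dots> = Poly_Mapping.lookup f m"
    by (simp add: in_keys_iff)
  finally show "Poly_Mapping.lookup f m = Poly_Mapping.lookup (\<Sum>m\<in>Poly_Mapping.keys f.
      Poly_Mapping.single m (Poly_Mapping.lookup f m)) m"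
    by simp
qed

text \<open>Covers both substitutions at once: evaluation, with \<open>c\<close> the identity, and
  the group action, with \<open>c\<close> the embedding of the constants.\<close>

locale coefficient_hom =
  fixes c :: "'k::field \<Rightarrow> 'r::comm_ring_1"
  assumes zero: "c 0 = 0" and one: "c 1 = 1"
    and add: "c (a + b) = c a + c b" and mult: "c (a * b) = c a * c b"
begin

lemma subst_superset:
  assumes "finite A" "Poly_Mapping.keys f \<subseteq> A"
  shows "mpoly_subst c x f = (\<Sum>m\<in>A. c (Poly_Mapping.lookup f m) * monomial_eval x m)"
  unfolding mpoly_subst_def monomial_eval_def using assms
  by (intro sum.mono_neutral_left) (auto simp: in_keys_iff zero)

lemma subst_add: "mpoly_subst c x (f + g) = mpoly_subst c x f + mpoly_subst c x g"
proof -
  let ?A = "Poly_Mapping.keys f \<union> Poly_Mapping.keys g"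
  have "Poly_Mapping.keys (f + g) \<subseteq> ?A"
    by (rule keys_add)
  then show ?thesis
    by (simp add: subst_superset[of ?A] lookup_add add distrib_right sum.distrib)
qed

lemma subst_0 [simp]: "mpoly_subst c x 0 = 0"
  by (simp add: mpoly_subst_def)

lemma subst_single: "mpoly_subst c x (Poly_Mapping.single m a) = c a * monomial_eval x m"
  by (simp add: mpoly_subst_def monomial_eval_def zero)

lemma subst_const: "mpoly_subst c x (mpoly_const a) = c a"
  by (simp add: mpoly_const_def subst_single)

lemma subst_var: "mpoly_subst c x (mpoly_var i) = x i"
  by (simp add: mpoly_var_def subst_single one)

lemma subst_sum: "mpoly_subst c x (\<Sum>a\<in>A. f a) = (\<Sum>a\<in>A. mpoly_subst c x (f a))"
  by (induction A rule: infinite_finite_induct) (simp_all add: subst_add)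

lemma subst_mult: "mpoly_subst c x (f * g) = mpoly_subst c x f * mpoly_subst c x g"
proof -
  let ?l = Poly_Mapping.lookup
  have "f * g = (\<Sum>m\<in>Poly_Mapping.keys f. Poly_Mapping.single m (?l f m)) *
      (\<Sum>m\<in>Poly_Mapping.keys g. Poly_Mapping.single m (?l g m))"
    by (rule arg_cong2[of _ _ _ _ "(*)"]; rule poly_mapping_sum_single)
  then have "f * g = (\<Sum>m\<in>Poly_Mapping.keys f. \<Sum>m'\<in>Poly_Mapping.keys g.
      Poly_Mapping.single (m + m') (?l f m * ?l g m'))"
    by (simp add: sum_product mult_single)
  then have "mpoly_subst c x (f * g) = (\<Sum>m\<in>Poly_Mapping.keys f. \<Sum>m'\<in>Poly_Mapping.keys g.
      (c (?l f m) * monomial_eval x m) * (c (?l g m') * monomial_eval x m'))"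
    by (simp add: subst_sum subst_single mult monomial_eval_add mult_ac)
  also have "\<dots> = mpoly_subst c x f * mpoly_subst c x g"
    by (simp add: subst_superset[OF finite_keys order_refl] sum_product)
  finally show ?thesis .
qed

lemma subst_1: "mpoly_subst c x 1 = 1"
  using subst_const[of x 1] by (simp add: one)

lemma subst_prod_list: "mpoly_subst c x (prod_list fs) = prod_list (map (mpoly_subst c x) fs)"
  by (induction fs) (simp_all add: subst_1 subst_mult)

end

interpretation eval_hom: coefficient_hom "\<lambda>a :: 'k::field. a"
  by unfold_locales simp_all

interpretation const_hom: coefficient_hom "mpoly_const :: 'k::field \<Rightarrow> 'k mpoly"
  by unfold_locales (simp_all add: mpoly_const_add mpoly_const_mult)

definition linear_form :: "nat \<Rightarrow> (nat \<Rightarrow> 'k) \<Rightarrow> 'k::field mpoly" where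
  "linear_form n u = (\<Sum>j<n. mpoly_const (u j) * mpoly_var j)"

lemma keys_linear_form:
  "Poly_Mapping.keys (linear_form n u) \<subseteq> (\<lambda>j. Poly_Mapping.single j 1) ` {..<n}"
proof -
  have "Poly_Mapping.keys (mpoly_const (u j) * mpoly_var j) \<subseteq> {Poly_Mapping.single j 1}" for j
    by (simp add: mpoly_const_def mpoly_var_def mult_single)
  then show ?thesis
    using keys_sum[of "\<lambda>j. mpoly_const (u j) * mpoly_var j" "{..<n}"]
    unfolding linear_form_def by blast
qed

lemma linear_form_in_mpoly_ring: "linear_form n u \<in> mpoly_ring n"
  using keys_linear_form[of n u] by (fastforce simp: mpoly_ring_def)

lemma total_degree_linear_form: "total_degree (linear_form n u) \<le> 1"
  using keys_linear_form[of n u] unfolding total_degree_le_iff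
  by (fastforce simp: mdegree_def)

lemma eval_linear_form: "mpoly_eval (linear_form n u) v = (\<Sum>j<n. u j * v $ j)"
  by (simp add: mpoly_eval_def linear_form_def eval_hom.subst_sum eval_hom.subst_mult
      eval_hom.subst_const eval_hom.subst_var)

lemma action_linear_form:
  "poly_action G n \<rho> g (linear_form n u) = linear_form n (\<lambda>j. \<Sum>i<n. u i * \<rho> (inv\<^bsub>G\<^esub> g) $$ (i, j))"
proof -
  have "poly_action G n \<rho> g (linear_form n u)
      = (\<Sum>i<n. \<Sum>j<n. mpoly_const (u i * \<rho> (inv\<^bsub>G\<^esub> g) $$ (i, j)) * mpoly_var j)"
    by (simp add: poly_action_def linear_form_def const_hom.subst_sum const_hom.subst_mult
        const_hom.subst_const const_hom.subst_var mpoly_const_mult sum_distrib_left mult.assoc)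
  also have "\<dots> = (\<Sum>j<n. \<Sum>i<n. mpoly_const (u i * \<rho> (inv\<^bsub>G\<^esub> g) $$ (i, j)) * mpoly_var j)"
    by (rule sum.swap)
  finally show ?thesis
    by (simp add: linear_form_def mpoly_const_sum sum_distrib_right)
qed

lemma prod_list_linear_forms:
  "prod_list (map (linear_form n) us) \<in> mpoly_ring n"
  "total_degree (prod_list (map (linear_form n) us)) \<le> length us"
proof (induction us)
  case Nil
  show "prod_list (map (linear_form n) []) \<in> mpoly_ring n"
    by (simp add: mpoly_ring_def)
  show "total_degree (prod_list (map (linear_form n) [])) \<le> length []"
    unfolding total_degree_le_iff by (simp add: mdegree_def)
next
  case (Cons u us)
  show "prod_list (map (linear_form n) (u # us)) \<in> mpoly_ring n"
    using Cons by (simp add: mpoly_ring_mult linear_form_in_mpoly_ring)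
  show "total_degree (prod_list (map (linear_form n) (u # us))) \<le> length (u # us)"
    using Cons total_degree_linear_form[of n u]
      total_degree_mult[of "linear_form n u" "prod_list (map (linear_form n) us)"] by simp
qed

section \<open>Invariants of representations\<close>

locale finite_representation = group G for G (structure) +
  fixes n :: nat and \<rho> :: "'a \<Rightarrow> 'k::field mat"
  assumes finite_carrier: "finite (carrier G)" and rep: "representation G n \<rho>"
begin

lemma
  shows rho_carrier: "g \<in> carrier G \<Longrightarrow> \<rho> g \<in> carrier_mat n n"
    and rho_mult: "g \<in> carrier G \<Longrightarrow> h \<in> carrier G \<Longrightarrow> \<rho> (g \<otimes> h) = \<rho> g * \<rho> h"
    and rho_one: "\<rho> \<one> = 1\<^sub>m n"
proof -
  let ?R = "ring_mat TYPE('k) n ()"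
  interpret R: ring ?R
    by (rule ring_mat)
  have hom: "\<rho> \<in> hom G (units_of ?R)"
    using rep by (simp add: representation_def)
  show "g \<in> carrier G \<Longrightarrow> \<rho> g \<in> carrier_mat n n"
    using hom by (auto simp: hom_def units_of_carrier Units_def ring_mat_simps)
  show "g \<in> carrier G \<Longrightarrow> h \<in> carrier G \<Longrightarrow> \<rho> (g \<otimes> h) = \<rho> g * \<rho> h"
    using hom by (simp add: hom_def units_of_mult ring_mat_simps)
  show "\<rho> \<one> = 1\<^sub>m n"
    using hom_one[OF hom is_group R.units_group] by (simp add: units_of_one ring_mat_simps)
qed

lemma rho_vec: "g \<in> carrier G \<Longrightarrow> u \<in> carrier_vec n \<Longrightarrow> \<rho> g *\<^sub>v u \<in> carrier_vec n"
  by (rule mult_mat_vec_carrier[OF rho_carrier])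

lemma rho_rho_vec:
  "g \<in> carrier G \<Longrightarrow> h \<in> carrier G \<Longrightarrow> u \<in> carrier_vec n \<Longrightarrow> \<rho> g *\<^sub>v (\<rho> h *\<^sub>v u) = \<rho> (g \<otimes> h) *\<^sub>v u"
  by (simp only: rho_mult assoc_mult_mat_vec[OF rho_carrier rho_carrier])

lemma rho_vec_index:
  "g \<in> carrier G \<Longrightarrow> u \<in> carrier_vec n \<Longrightarrow> i < n \<Longrightarrow> (\<rho> g *\<^sub>v u) $ i = (\<Sum>j<n. \<rho> g $$ (i, j) * u $ j)"
  using rho_carrier[of g] by (simp add: scalar_prod_def lessThan_atLeast0)

lemma orbit_rho_vec:
  assumes "h \<in> carrier G" "u \<in> carrier_vec n"
  shows "module_orbit G \<rho> (\<rho> h *\<^sub>v u) = module_orbit G \<rho> u"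
proof -
  have "\<exists>k\<in>carrier G. \<rho> g *\<^sub>v u = \<rho> k *\<^sub>v (\<rho> h *\<^sub>v u)" if "g \<in> carrier G" for g
    using assms that by (intro bexI[of _ "g \<otimes> inv h"]) (simp_all add: rho_rho_vec m_assoc)
  moreover have "\<exists>k\<in>carrier G. \<rho> g *\<^sub>v (\<rho> h *\<^sub>v u) = \<rho> k *\<^sub>v u" if "g \<in> carrier G" for g
    using assms that by (intro bexI[of _ "g \<otimes> h"]) (simp_all add: rho_rho_vec)
  ultimately show ?thesis
    unfolding module_orbit_def orbit_def by blast
qed

text \<open>The row vector \<open>u\<close> times the matrix \<open>\<rho> g\<close>, that is, the
  coefficients of the linear form \<open>u\<close> composed with \<open>g\<close>.\<close>

definition pull :: "(nat \<Rightarrow> 'k) \<Rightarrow> 'a \<Rightarrow> nat \<Rightarrow> 'k" where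
  "pull u g = (\<lambda>j. \<Sum>i<n. u i * \<rho> g $$ (i, j))"

lemma pull_mult:
  assumes "g \<in> carrier G" "h \<in> carrier G" "j < n"
  shows "(\<Sum>i<n. pull u g i * \<rho> h $$ (i, j)) = pull u (g \<otimes> h) j"
proof -
  have "\<rho> (g \<otimes> h) $$ (i, j) = (\<Sum>k<n. \<rho> g $$ (i, k) * \<rho> h $$ (k, j))" if "i < n" for i
    using assms that rho_carrier[of g] rho_carrier[of h]
    by (simp add: rho_mult scalar_prod_def lessThan_atLeast0)
  then have "pull u (g \<otimes> h) j = (\<Sum>i<n. \<Sum>k<n. u i * (\<rho> g $$ (i, k) * \<rho> h $$ (k, j)))"
    by (simp add: pull_def sum_distrib_left)
  also have "\<dots> = (\<Sum>k<n. \<Sum>i<n. u i * (\<rho> g $$ (i, k) * \<rho> h $$ (k, j)))"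
    by (rule sum.swap)
  finally show ?thesis
    by (simp add: pull_def sum_distrib_right mult.assoc)
qed

lemma pull_vec:
  assumes "g \<in> carrier G" "v \<in> carrier_vec n"
  shows "(\<Sum>j<n. pull u g j * v $ j) = (\<Sum>i<n. u i * (\<rho> g *\<^sub>v v) $ i)"
proof -
  have "(\<Sum>j<n. pull u g j * v $ j) = (\<Sum>j<n. \<Sum>i<n. u i * (\<rho> g $$ (i, j) * v $ j))"
    by (simp add: pull_def sum_distrib_right mult.assoc)
  also have "\<dots> = (\<Sum>i<n. \<Sum>j<n. u i * (\<rho> g $$ (i, j) * v $ j))"
    by (rule sum.swap)
  finally show ?thesis
    using assms by (simp add: rho_vec_index sum_distrib_left)
qed

text \<open>The Reynolds operator on a product of linear forms, without the factor 1/|G|.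
  Restricting to such products keeps degree and values explicit.\<close>

definition reynolds :: "(nat \<Rightarrow> 'k) list \<Rightarrow> 'k mpoly" where
  "reynolds us = (\<Sum>g\<in>carrier G. prod_list (map (linear_form n) (map (\<lambda>u. pull u g) us)))"

lemma action_pull:
  assumes "g \<in> carrier G" "h \<in> carrier G"
  shows "poly_action G n \<rho> h (linear_form n (pull u g)) = linear_form n (pull u (g \<otimes> inv h))"
  unfolding action_linear_form using pull_mult[OF assms(1) inv_closed[OF assms(2)]]
  by (simp add: linear_form_def)

text \<open>\<open>h\<close> carries the summand of \<open>g\<close> to that of
  \<open>g \<otimes> inv h\<close>, so it permutes the summands.\<close>

lemma reynolds_invariant: "reynolds us \<in> invariants G n \<rho>"
proof -
  have "poly_action G n \<rho> h (reynolds us) = reynolds us" if h: "h \<in> carrier G" for h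
  proof -
    have "poly_action G n \<rho> h (prod_list (map (linear_form n) (map (\<lambda>u. pull u g) us)))
        = prod_list (map (linear_form n) (map (\<lambda>u. pull u (g \<otimes> inv h)) us))" if "g \<in> carrier G" for g
      using action_pull[OF that h]
      by (simp add: poly_action_def const_hom.subst_prod_list o_def)
    then have "poly_action G n \<rho> h (reynolds us)
        = (\<Sum>g\<in>carrier G. prod_list (map (linear_form n) (map (\<lambda>u. pull u (g \<otimes> inv h)) us)))"
      by (simp add: reynolds_def poly_action_def const_hom.subst_sum)
    also have "\<dots> = reynolds us"
      unfolding reynolds_def
      by (rule sum.reindex_bij_witness[of _ "\<lambda>g. g \<otimes> h" "\<lambda>g. g \<otimes> inv h"])
        (use h in \<open>simp_all add: m_assoc\<close>)
    finally show ?thesis .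
  qed
  moreover have "reynolds us \<in> mpoly_ring n"
    unfolding reynolds_def by (rule mpoly_ring_sum) (rule prod_list_linear_forms)
  ultimately show ?thesis
    by (simp add: invariants_def)
qed

lemma total_degree_reynolds: "total_degree (reynolds us) \<le> length us"
  unfolding reynolds_def
proof (rule total_degree_sum)
  fix g
  show "total_degree (prod_list (map (linear_form n) (map (\<lambda>u. pull u g) us))) \<le> length us"
    using prod_list_linear_forms(2)[of n "map (\<lambda>u. pull u g) us"] by simp
qed

lemma eval_reynolds:
  assumes "v \<in> carrier_vec n"
  shows "mpoly_eval (reynolds us) v
    = (\<Sum>g\<in>carrier G. prod_list (map (\<lambda>u. \<Sum>i<n. u i * (\<rho> g *\<^sub>v v) $ i) us))"
proof -
  have "mpoly_eval (reynolds us) v = (\<Sum>g\<in>carrier G. prod_list (map (\<lambda>u. mpoly_eval (linear_form n (pull u g)) v) us))"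
    by (simp add: mpoly_eval_def reynolds_def eval_hom.subst_sum eval_hom.subst_prod_list o_def)
  also have "\<dots> = (\<Sum>g\<in>carrier G. prod_list (map (\<lambda>u. \<Sum>i<n. u i * (\<rho> g *\<^sub>v v) $ i) us))"
    by (intro sum.cong refl) (simp add: eval_linear_form pull_vec assms)
  finally show ?thesis .
qed

end

section \<open>Decomposition into weight components\<close>

lemma cpow_sum:
  assumes "\<omega> ^ 3 = 1" "\<omega> \<noteq> (1 :: 'k::field)"
  shows "(\<Sum>i\<in>UNIV. cpow \<omega> (i * a)) = (if a = 0 then 3 else 0)"
proof -
  have "(\<Sum>i\<in>UNIV. cpow \<omega> (i * a)) = cpow \<omega> 0 + (cpow \<omega> a + cpow \<omega> (2 * a))"
    unfolding UNIV_3 by simp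
  moreover have "1 + \<omega> + \<omega>\<^sup>2 = 0"
    using cube_root_of_unity_sum[OF assms] by (simp add: ac_simps)
  ultimately show ?thesis
    using cases_3[of a] by (auto simp: cpow_def ac_simps)
qed

lemma pairing_add_left: "pairing (a + b) u = pairing a u + pairing b u"
  and pairing_add_right: "pairing u (a + b) = pairing u a + pairing u b"
  and pairing_0 [simp]: "pairing 0 u = 0" "pairing u 0 = 0"
  and pairing_flip: "pairing (flip a) u = pairing a (flip u)"
  and flip_uminus: "flip (- a) = - flip a"
  by (simp_all add: pairing_def flip_def distrib_left distrib_right)

text \<open>Retains from the group an embedded C_3 x C_3, written additively through
  \<open>\<sigma>\<close>, and an involution \<open>t\<close> acting on it by \<open>flip\<close>,
  whose two cosets exhaust the group.\<close>

locale split_representation = finite_representation G n \<rho>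
  for G (structure) and n and \<rho> :: "'a \<Rightarrow> 'k::field mat" +
  fixes \<sigma> :: "3 \<times> 3 \<Rightarrow> 'a" and t :: 'a and \<omega> :: 'k
  assumes sigma_closed: "\<sigma> a \<in> carrier G" and t_closed: "t \<in> carrier G"
    and sigma_add: "\<sigma> (a + b) = \<sigma> a \<otimes> \<sigma> b" and sigma_zero: "\<sigma> 0 = \<one>"
    and t_t: "t \<otimes> t = \<one>" and t_sigma: "t \<otimes> \<sigma> a = \<sigma> (flip a) \<otimes> t"
    and sigma_inj: "inj \<sigma>" and carrier_eq: "carrier G = range \<sigma> \<union> range (\<lambda>a. \<sigma> a \<otimes> t)"
    and cosets_disjoint: "range \<sigma> \<inter> range (\<lambda>a. \<sigma> a \<otimes> t) = {}"
    and omega: "\<omega> ^ 3 = 1" "\<omega> \<noteq> 1" and two: "(2 :: 'k) \<noteq> 0" and three: "(3 :: 'k) \<noteq> 0"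
begin

definition ch :: "3 \<times> 3 \<Rightarrow> 3 \<times> 3 \<Rightarrow> 'k" where
  "ch a b = cpow \<omega> (pairing a b)"

lemma ch_add_left: "ch (a + b) u = ch a u * ch b u"
  and ch_add_right: "ch u (a + b) = ch u a * ch u b"
  and ch_0 [simp]: "ch 0 u = 1" "ch u 0 = 1"
  and ch_flip: "ch (flip a) u = ch a (flip u)"
  by (simp_all add: ch_def pairing_add_left pairing_add_right pairing_flip cpow_add[OF omega(1)])

lemma ch_orthogonal: "(\<Sum>a\<in>UNIV. ch a b) = (if b = 0 then 9 else 0)"
proof -
  have "(\<Sum>a\<in>UNIV. ch a b) = (\<Sum>i\<in>UNIV. \<Sum>j\<in>UNIV. cpow \<omega> (i * fst b) * cpow \<omega> (j * snd b))"
    unfolding sum.cartesian_product UNIV_Times_UNIV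
    by (simp add: ch_def pairing_def split_def cpow_add[OF omega(1)])
  also have "\<dots> = (\<Sum>i\<in>UNIV. cpow \<omega> (i * fst b)) * (\<Sum>j\<in>UNIV. cpow \<omega> (j * snd b))"
    by (simp add: sum_product)
  finally show ?thesis
    by (simp add: cpow_sum[OF omega] prod_eq_iff)
qed

text \<open>Entries of the projection to the component of weight \<open>a\<close>, as an average
  over C_3 x C_3. Keeping the original coordinates avoids choosing a basis of weight vectors; the
  default 0 makes components vanish beyond the dimension.\<close>

definition coeff :: "3 \<times> 3 \<Rightarrow> nat \<Rightarrow> nat \<Rightarrow> 'k" where
  "coeff a i j = (if i < n then (\<Sum>b\<in>UNIV. ch a (- b) * \<rho> (\<sigma> b) $$ (i, j)) / 9 else 0)"

definition comp :: "'k vec \<Rightarrow> 3 \<times> 3 \<Rightarrow> nat \<Rightarrow> 'k" where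
  "comp u a i = (\<Sum>j<n. coeff a i j * u $ j)"

lemma comp_outside: "i \<ge> n \<Longrightarrow> comp u a i = 0"
  by (simp add: comp_def coeff_def)

lemma comp_eq:
  assumes "u \<in> carrier_vec n" "i < n"
  shows "comp u a i = (\<Sum>b\<in>UNIV. ch a (- b) * (\<rho> (\<sigma> b) *\<^sub>v u) $ i) / 9"
proof -
  have "comp u a i = (\<Sum>j<n. \<Sum>b\<in>UNIV. ch a (- b) * (\<rho> (\<sigma> b) $$ (i, j) * u $ j)) / 9"
    using assms by (simp add: comp_def coeff_def sum_divide_distrib sum_distrib_right mult.assoc)
  also have "\<dots> = (\<Sum>b\<in>UNIV. \<Sum>j<n. ch a (- b) * (\<rho> (\<sigma> b) $$ (i, j) * u $ j)) / 9"
    by (subst sum.swap) simp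
  finally show ?thesis
    using assms sigma_closed by (simp add: rho_vec_index sum_distrib_left)
qed

lemma comp_sigma:
  assumes "u \<in> carrier_vec n"
  shows "comp (\<rho> (\<sigma> b) *\<^sub>v u) a i = ch a b * comp u a i"
proof (cases "i < n")
  case True
  have "(\<Sum>c\<in>UNIV. ch a (- c) * (\<rho> (\<sigma> c) *\<^sub>v (\<rho> (\<sigma> b) *\<^sub>v u)) $ i)
      = (\<Sum>c\<in>UNIV. ch a b * (ch a (- (c + b)) * (\<rho> (\<sigma> (c + b)) *\<^sub>v u) $ i))"
  proof (rule sum.cong[OF refl])
    fix c
    have "ch a (- c) = ch a b * ch a (- (c + b))"
      by (simp add: ch_add_right[symmetric])
    then show "ch a (- c) * (\<rho> (\<sigma> c) *\<^sub>v (\<rho> (\<sigma> b) *\<^sub>v u)) $ i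
        = ch a b * (ch a (- (c + b)) * (\<rho> (\<sigma> (c + b)) *\<^sub>v u) $ i)"
      using assms sigma_closed by (simp add: rho_rho_vec sigma_add)
  qed
  also have "\<dots> = (\<Sum>c\<in>UNIV. ch a b * (ch a (- c) * (\<rho> (\<sigma> c) *\<^sub>v u) $ i))"
    by (rule sum.reindex_bij_witness[of _ "\<lambda>c. c - b" "\<lambda>c. c + b"]) simp_all
  finally show ?thesis
    using assms True sigma_closed by (simp add: comp_eq rho_vec sum_distrib_left)
qed (simp add: comp_outside)

lemma nine: "(9 :: 'k) \<noteq> 0"
proof -
  have "(9 :: 'k) = 3 * 3"
    by simp
  then show ?thesis
    using three by (simp only: mult_eq_0_iff) simp
qed

lemma sum_comp:
  assumes "u \<in> carrier_vec n" "i < n"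
  shows "(\<Sum>a\<in>UNIV. comp u a i) = u $ i"
proof -
  have "(\<Sum>a\<in>UNIV. comp u a i) = (\<Sum>a\<in>UNIV. \<Sum>b\<in>UNIV. ch a (- b) * (\<rho> (\<sigma> b) *\<^sub>v u) $ i) / 9"
    using assms by (simp add: comp_eq sum_divide_distrib)
  also have "\<dots> = (\<Sum>b\<in>UNIV. \<Sum>a\<in>UNIV. ch a (- b) * (\<rho> (\<sigma> b) *\<^sub>v u) $ i) / 9"
    by (subst sum.swap) simp
  also have "\<dots> = (\<Sum>b\<in>UNIV. (if b = 0 then 9 * (\<rho> (\<sigma> b) *\<^sub>v u) $ i else 0)) / 9"
    by (simp add: sum_distrib_right[symmetric] ch_orthogonal if_distrib[of "\<lambda>x. x * _"] cong: if_cong)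
  also have "\<dots> = u $ i"
    using nine assms by (simp add: sigma_zero rho_one)
  finally show ?thesis .
qed

definition T :: "(nat \<Rightarrow> 'k) \<Rightarrow> nat \<Rightarrow> 'k" where
  "T f i = (if i < n then \<Sum>j<n. \<rho> t $$ (i, j) * f j else 0)"

lemma T_smul: "T (smul c f) = smul c (T f)"
  by (auto simp: T_def smul_def sum_distrib_left mult_ac)

text \<open>Moving \<open>t\<close> past \<open>\<sigma> b\<close> flips \<open>b\<close>, and
  reindexing the average transfers the flip to the weight.\<close>

lemma T_comp:
  assumes "u \<in> carrier_vec n"
  shows "T (comp u a) = comp (\<rho> t *\<^sub>v u) (flip a)"
proof
  fix i
  show "T (comp u a) i = comp (\<rho> t *\<^sub>v u) (flip a) i"
  proof (cases "i < n")
    case True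
    have "T (comp u a) i = (\<Sum>j<n. \<Sum>b\<in>UNIV. ch a (- b) * (\<rho> t $$ (i, j) * (\<rho> (\<sigma> b) *\<^sub>v u) $ j)) / 9"
      using True assms by (simp add: T_def comp_eq sum_divide_distrib sum_distrib_left mult_ac)
    also have "\<dots> = (\<Sum>b\<in>UNIV. \<Sum>j<n. ch a (- b) * (\<rho> t $$ (i, j) * (\<rho> (\<sigma> b) *\<^sub>v u) $ j)) / 9"
      by (subst sum.swap) simp
    also have "\<dots> = (\<Sum>b\<in>UNIV. ch a (- b) * (\<rho> t *\<^sub>v (\<rho> (\<sigma> b) *\<^sub>v u)) $ i) / 9"
      using True assms sigma_closed t_closed
      by (simp add: rho_vec_index[of t] rho_vec sum_distrib_left del: index_mult_mat_vec)
    also have "\<dots> = (\<Sum>b\<in>UNIV. ch (flip a) (- flip b) * (\<rho> (\<sigma> (flip b)) *\<^sub>v (\<rho> t *\<^sub>v u)) $ i) / 9"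
      using assms sigma_closed t_closed by (simp add: rho_rho_vec t_sigma ch_flip flip_uminus)
    also have "\<dots> = (\<Sum>b\<in>UNIV. ch (flip a) (- b) * (\<rho> (\<sigma> b) *\<^sub>v (\<rho> t *\<^sub>v u)) $ i) / 9"
      by (intro arg_cong2[of _ _ _ _ "(/)"] refl sum.reindex_bij_witness[of _ flip flip]) simp_all
    finally show ?thesis
      using True assms t_closed by (simp add: comp_eq rho_vec)
  qed (simp add: T_def comp_outside)
qed

lemma mon_comp_sigma:
  assumes "u \<in> carrier_vec n" "weight l = 0"
  shows "mon (comp (\<rho> (\<sigma> b) *\<^sub>v u)) l = mon (comp u) l"
proof -
  have "mon (comp (\<rho> (\<sigma> b) *\<^sub>v u)) l = ch (weight l) b * mon (comp u) l"
  proof (induction l)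
    case (Cons p l)
    then show ?case
      by (cases p) (simp add: comp_sigma assms(1) ch_add_left)
  qed simp
  then show ?thesis
    using assms by simp
qed

lemma sum_carrier: "(\<Sum>g\<in>carrier G. f g) = (\<Sum>a\<in>UNIV. f (\<sigma> a)) + (\<Sum>a\<in>UNIV. f (\<sigma> a \<otimes> t))"
proof -
  have inj: "inj (\<lambda>a. \<sigma> a \<otimes> t)"
    using sigma_inj sigma_closed t_closed by (auto simp: inj_def)
  have "(\<Sum>g\<in>carrier G. f g) = (\<Sum>g\<in>range \<sigma>. f g) + (\<Sum>g\<in>range (\<lambda>a. \<sigma> a \<otimes> t). f g)"
    unfolding carrier_eq by (rule sum.union_disjoint) (use cosets_disjoint in auto)
  then show ?thesis
    by (simp add: sum.reindex[OF inj] sum.reindex[OF sigma_inj])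
qed

text \<open>A monomial of weight 0 is constant along C_3 x C_3, so each of the two cosets
  contributes nine equal terms.\<close>

lemma sum_mon_comp:
  assumes "u \<in> carrier_vec n" "weight l = 0"
  shows "(\<Sum>g\<in>carrier G. mon (comp (\<rho> g *\<^sub>v u)) l) = 9 * (mon (comp u) l + mon (comp (\<rho> t *\<^sub>v u)) l)"
proof -
  have "mon (comp (\<rho> (\<sigma> a \<otimes> t) *\<^sub>v u)) l = mon (comp (\<rho> t *\<^sub>v u)) l" for a
    using mon_comp_sigma[of "\<rho> t *\<^sub>v u" l a] assms sigma_closed t_closed
    by (simp add: rho_rho_vec rho_vec)
  then show ?thesis
    using assms by (simp add: sum_carrier mon_comp_sigma)
qed

lemma comp_determines:
  assumes "u \<in> carrier_vec n" "u' \<in> carrier_vec n"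
    and "\<And>a. comp u' a = smul (cpow \<omega> (pairing a b)) (comp u a)"
  shows "u' = \<rho> (\<sigma> b) *\<^sub>v u"
proof (rule eq_vecI)
  show "u' $ i = (\<rho> (\<sigma> b) *\<^sub>v u) $ i" if "i < dim_vec (\<rho> (\<sigma> b) *\<^sub>v u)" for i
  proof -
    have i: "i < n"
      using that rho_carrier[OF sigma_closed, of b] by simp
    have "u' $ i = (\<Sum>a\<in>UNIV. comp (\<rho> (\<sigma> b) *\<^sub>v u) a i)"
      using assms i sum_comp[of u' i] by (simp add: comp_sigma smul_def ch_def)
    then show ?thesis
      using assms i sigma_closed by (simp add: sum_comp rho_vec del: index_mult_mat_vec)
  qed
  show "dim_vec u' = dim_vec (\<rho> (\<sigma> b) *\<^sub>v u)"
    using assms rho_carrier[OF sigma_closed, of b] by simp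
qed

lemma orbits_eq:
  assumes v: "v \<in> carrier_vec n" and w: "w \<in> carrier_vec n"
    and agree: "\<And>f. f \<in> invariants G n \<rho> \<Longrightarrow> total_degree f \<le> 6 \<Longrightarrow> mpoly_eval f v = mpoly_eval f w"
  shows "module_orbit G \<rho> v = module_orbit G \<rho> w"
proof -
  define v' w' where "v' = \<rho> t *\<^sub>v v" and "w' = \<rho> t *\<^sub>v w"
  have v': "v' \<in> carrier_vec n" and w': "w' \<in> carrier_vec n"
    using v w t_closed by (simp_all add: v'_def w'_def rho_vec)
  have tt: "\<rho> t *\<^sub>v v' = v" "\<rho> t *\<^sub>v w' = w"
    using v w t_closed by (simp_all add: v'_def w'_def rho_rho_vec t_t rho_one)
  have moments: "mon (comp v) l + mon (comp v') l = mon (comp w) l + mon (comp w') l"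
    if l: "length l \<le> 6" "weight l = 0" for l
  proof -
    let ?us = "map (\<lambda>(a, i). coeff a i) l"
    have mon_eq: "prod_list (map (\<lambda>u. \<Sum>i<n. u i * x $ i) ?us) = mon (comp x) l" for x
      by (simp add: mon_def comp_def o_def split_def)
    have "mpoly_eval (reynolds ?us) v = mpoly_eval (reynolds ?us) w"
      using agree[OF reynolds_invariant] total_degree_reynolds[of ?us] l by simp
    then have "9 * (mon (comp v) l + mon (comp v') l) = 9 * (mon (comp w) l + mon (comp w') l)"
      unfolding eval_reynolds[OF v] eval_reynolds[OF w] mon_eq sum_mon_comp[OF v l(2)] sum_mon_comp[OF w l(2)]
      by (simp only: v'_def w'_def)
    then show ?thesis
      by (simp only: mult_left_cancel[OF nine])
  qed
  \<comment> \<open>Stated for a variable point because it is applied to \<open>w\<close> or to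
    \<open>w'\<close>; passing from one to the other only swaps the two summands of a
    moment.\<close>
  have same: "module_orbit G \<rho> v = module_orbit G \<rho> x"
    if x: "x \<in> carrier_vec n" and mon_agree: "\<And>l. length l \<le> 3 \<Longrightarrow> weight l = 0 \<Longrightarrow> mon (comp v) l = mon (comp x) l"
      and mx: "\<And>l. length l \<le> 6 \<Longrightarrow> weight l = 0 \<Longrightarrow>
          mon (comp v) l + mon (comp v') l = mon (comp x) l + mon (comp (\<rho> t *\<^sub>v x)) l" for x
  proof -
    interpret swapped_weight_vectors \<omega> T "comp v" "comp v'" "comp x" "comp (\<rho> t *\<^sub>v x)"
      by unfold_locales
        (use two omega T_smul T_comp[OF v] T_comp[OF v'] T_comp[OF x] tt mx mon_agree in \<open>auto simp: v'_def\<close>)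
    from related obtain b where "x = \<rho> (\<sigma> b) *\<^sub>v v \<or> x = \<rho> (\<sigma> b) *\<^sub>v v'"
      using comp_determines[OF v x] comp_determines[OF v' x] by blast
    then show ?thesis
      using orbit_rho_vec sigma_closed t_closed v v' unfolding v'_def by metis
  qed
  from pairs_agree_or_swap[OF two moments] show ?thesis
  proof
    assume "\<forall>l. length l \<le> 3 \<longrightarrow> weight l = 0 \<longrightarrow> mon (comp v) l = mon (comp w) l"
    then show ?thesis
      using same[OF w] moments by (simp add: w'_def)
  next
    assume "\<forall>l. length l \<le> 3 \<longrightarrow> weight l = 0 \<longrightarrow> mon (comp v) l = mon (comp w') l"
    then have "module_orbit G \<rho> v = module_orbit G \<rho> w'"
      using same[OF w'] moments by (simp add: tt add.commute)
    then show ?thesis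
      using orbit_rho_vec[OF t_closed w] by (simp add: w'_def)
  qed
qed

lemma beta_sep_module_le: "beta_sep_module G n \<rho> \<le> 6"
proof -
  have "separating_set G n \<rho> {f \<in> invariants G n \<rho>. total_degree f \<le> 6}"
    unfolding separating_set_def using orbits_eq by blast
  then have "enat 6 \<in> {enat d | d. d > 0 \<and> separating_set G n \<rho> {f \<in> invariants G n \<rho>. total_degree f \<le> d}}"
    by auto
  then have "beta_sep_module G n \<rho> \<le> enat 6"
    unfolding beta_sep_module_def by (rule Inf_lower)
  then show ?thesis
    by (simp add: numeral_eq_enat)
qed

end

section \<open>The group and the lower bound\<close>

text \<open>The powers of the 3-cycle 1 -> 2 -> 3 -> 1.\<close>

definition rot :: "3 \<Rightarrow> nat \<Rightarrow> nat" where
  "rot a = (if a = 0 then id else if a = 1 then transpose 1 2 \<circ> transpose 2 3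
            else transpose 2 3 \<circ> transpose 1 2)"

definition int_of_3 :: "3 \<Rightarrow> int" where
  "int_of_3 a = (if a = 0 then 0 else if a = 1 then 1 else 2)"

abbreviation S3C3 :: "((nat \<Rightarrow> nat) \<times> int) monoid" where
  "S3C3 \<equiv> sym_group 3 \<times>\<times> integer_mod_group 3"

definition S3C3_sigma :: "3 \<times> 3 \<Rightarrow> (nat \<Rightarrow> nat) \<times> int" where
  "S3C3_sigma a = (rot (fst a), int_of_3 (snd a))"

definition S3C3_t :: "(nat \<Rightarrow> nat) \<times> int" where
  "S3C3_t = (transpose 1 2, 0)"

lemma rot_add: "rot (a + b) = rot a \<circ> rot b"
  using cases_3[of a] cases_3[of b]
  by (elim disjE) (simp_all add: rot_def fun_eq_iff transpose_def)

lemma int_of_3_add: "int_of_3 (a + b) = (int_of_3 a + int_of_3 b) mod 3"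
  using cases_3[of a] cases_3[of b] by (elim disjE) (simp_all add: int_of_3_def)

lemma transpose_rot: "transpose 1 2 \<circ> rot a = rot (- a) \<circ> transpose 1 2"
  using cases_3[of a] by (elim disjE) (simp_all add: rot_def fun_eq_iff transpose_def)

lemma transpose_permutes: "transpose 1 2 permutes {1..3 :: nat}"
  by (auto intro: permutes_swap_id)

lemma rot_permutes: "rot a permutes {1..3}"
proof -
  have "transpose 2 3 permutes {1..3 :: nat}"
    by (auto intro: permutes_swap_id)
  with transpose_permutes show ?thesis
    by (simp add: rot_def permutes_compose permutes_id)
qed

text \<open>The images of 1 and 2 tell the rotations apart, and no pair in this list is the reverse
  of a pair in it, which separates rotations from reflections.\<close>

lemma rot_values:
  "(rot 0 1, rot 0 2) = (1, 2)" "(rot 1 1, rot 1 2) = (2, 3)" "(rot 2 1, rot 2 2) = (3, 1)"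
  by (simp_all add: rot_def transpose_def)

lemma rot_inj: "rot a = rot b \<Longrightarrow> a = b"
  using rot_values cases_3[of a] cases_3[of b] by auto

lemma rot_neq: "rot a \<noteq> rot b \<circ> transpose 1 2"
proof
  assume "rot a = rot b \<circ> transpose 1 2"
  then have "rot a 1 = rot b 2" "rot a 2 = rot b 1"
    by simp_all
  then show False
    using rot_values cases_3[of a] cases_3[of b] by auto
qed

text \<open>By counting: three rotations and three reflections make up 3! elements.\<close>

lemma carrier_sym_group_3:
  "carrier (sym_group 3) = range rot \<union> range (\<lambda>a. rot a \<circ> transpose 1 2)"
proof (rule sym, rule card_seteq)
  show "finite (carrier (sym_group 3))"
    using sym_group_card_carrier[of 3] by (intro card_ge_0_finite) simp
  show "range rot \<union> range (\<lambda>a. rot a \<circ> transpose 1 2) \<subseteq> carrier (sym_group 3)"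
    using rot_permutes permutes_compose[OF transpose_permutes rot_permutes]
    by (auto simp: sym_group_carrier simp del: One_nat_def)
  have "inj rot" "inj (\<lambda>a. rot a \<circ> transpose 1 2)"
    using rot_inj by (auto simp: inj_def fun_eq_iff) (metis ext transpose_involutory)
  moreover have "card (UNIV :: 3 set) = 3"
    by simp
  ultimately have "card (range rot \<union> range (\<lambda>a. rot a \<circ> transpose 1 2)) = 3 + 3"
    using rot_neq by (subst card_Un_disjoint) (auto simp: card_image)
  then show "card (carrier (sym_group 3)) \<le> card (range rot \<union> range (\<lambda>a. rot a \<circ> transpose 1 2))"
    by (simp add: sym_group_card_carrier fact_numeral)
qed

lemma range_int_of_3: "range int_of_3 = {0..<3}"
  unfolding UNIV_3 by (auto simp: int_of_3_def)

lemma group_S3C3: "group S3C3"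
  by (intro DirProd_group sym_group_is_group group_integer_mod_group)

lemma carrier_S3C3: "carrier S3C3 = range S3C3_sigma \<union> range (\<lambda>a. S3C3_sigma a \<otimes>\<^bsub>S3C3\<^esub> S3C3_t)"
proof -
  have "(int_of_3 b + 0) mod 3 = int_of_3 b" for b
    using int_of_3_add[of b 0] by (simp add: int_of_3_def)
  then have "(\<lambda>a. S3C3_sigma a \<otimes>\<^bsub>S3C3\<^esub> S3C3_t) = (\<lambda>a. (rot (fst a) \<circ> transpose 1 2, int_of_3 (snd a)))"
    by (simp add: S3C3_sigma_def S3C3_t_def sym_group_mult)
  moreover have rng: "range (\<lambda>a. (f (fst a), h (snd a))) = range f \<times> range h"
    for f :: "3 \<Rightarrow> nat \<Rightarrow> nat" and h :: "3 \<Rightarrow> int"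
    using map_prod_surj_on[of f UNIV "range f" h UNIV "range h"] by (simp add: map_prod_def split_def)
  ultimately have "range (\<lambda>a. S3C3_sigma a \<otimes>\<^bsub>S3C3\<^esub> S3C3_t) = range (\<lambda>a. rot a \<circ> transpose 1 2) \<times> range int_of_3"
    using rng[of "\<lambda>a. rot a \<circ> transpose 1 2" int_of_3] by (simp only:)
  moreover have "range S3C3_sigma = range rot \<times> range int_of_3"
    using rng[of rot int_of_3] by (simp add: S3C3_sigma_def)
  ultimately show ?thesis
    by (simp add: carrier_sym_group_3 carrier_integer_mod_group range_int_of_3 Sigma_Un_distrib1)
qed

lemma split_representation_S3C3:
  assumes "representation S3C3 n (\<rho> :: _ \<Rightarrow> 'k::field mat)"
    and "\<omega> ^ 3 = (1 :: 'k)" "\<omega> \<noteq> 1" "(2 :: 'k) \<noteq> 0" "(3 :: 'k) \<noteq> 0"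
  shows "split_representation S3C3 n \<rho> S3C3_sigma S3C3_t \<omega>"
proof -
  interpret group S3C3
    by (rule group_S3C3)
  have inj: "inj int_of_3"
    using cases_3 by (auto simp: inj_def int_of_3_def split: if_splits)
  show ?thesis
  proof unfold_locales
    show "finite (carrier S3C3)"
      unfolding carrier_S3C3 by simp
    show "S3C3_sigma a \<in> carrier S3C3" for a
      unfolding carrier_S3C3 by blast
    show "S3C3_t \<in> carrier S3C3"
      using transpose_permutes
      by (simp add: S3C3_t_def sym_group_carrier carrier_integer_mod_group)
    show "S3C3_sigma (a + b) = S3C3_sigma a \<otimes>\<^bsub>S3C3\<^esub> S3C3_sigma b" for a b
      by (simp add: S3C3_sigma_def sym_group_mult rot_add int_of_3_add)
    show "S3C3_sigma 0 = \<one>\<^bsub>S3C3\<^esub>"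
      by (simp add: S3C3_sigma_def sym_group_one rot_def int_of_3_def)
    show "S3C3_t \<otimes>\<^bsub>S3C3\<^esub> S3C3_t = \<one>\<^bsub>S3C3\<^esub>"
      by (simp add: S3C3_t_def sym_group_mult sym_group_one)
    show "S3C3_t \<otimes>\<^bsub>S3C3\<^esub> S3C3_sigma a = S3C3_sigma (flip a) \<otimes>\<^bsub>S3C3\<^esub> S3C3_t" for a
      using transpose_rot[of "fst a"]
      by (simp add: S3C3_t_def S3C3_sigma_def sym_group_mult flip_def)
    show "inj S3C3_sigma"
      using rot_inj inj by (auto simp: inj_def S3C3_sigma_def prod_eq_iff)
    show "range S3C3_sigma \<inter> range (\<lambda>a. S3C3_sigma a \<otimes>\<^bsub>S3C3\<^esub> S3C3_t) = {}"
      using rot_neq by (auto simp: S3C3_sigma_def S3C3_t_def sym_group_mult)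
    show "carrier S3C3 = range S3C3_sigma \<union> range (\<lambda>a. S3C3_sigma a \<otimes>\<^bsub>S3C3\<^esub> S3C3_t)"
      by (rule carrier_S3C3)
  qed (use assms in simp_all)
qed

section \<open>A one-dimensional representation with image of order 6\<close>

lemma representationI:
  fixes \<rho> :: "'g \<Rightarrow> 'k::field mat"
  assumes "group G" "\<And>g. g \<in> carrier G \<Longrightarrow> \<rho> g \<in> carrier_mat n n" "\<rho> \<one>\<^bsub>G\<^esub> = 1\<^sub>m n"
    and mult: "\<And>g h. g \<in> carrier G \<Longrightarrow> h \<in> carrier G \<Longrightarrow> \<rho> (g \<otimes>\<^bsub>G\<^esub> h) = \<rho> g * \<rho> h"
  shows "representation G n \<rho>"
proof -
  interpret group G
    by fact
  have "\<rho> g \<in> Units (ring_mat TYPE('k) n ())" if g: "g \<in> carrier G" for g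
  proof -
    have "\<rho> (inv\<^bsub>G\<^esub> g) * \<rho> g = 1\<^sub>m n" "\<rho> g * \<rho> (inv\<^bsub>G\<^esub> g) = 1\<^sub>m n"
      using g assms(3) by (simp_all add: mult[symmetric])
    then show ?thesis
      using g assms(2) by (auto simp: Units_def ring_mat_simps intro!: bexI[of _ "\<rho> (inv\<^bsub>G\<^esub> g)"])
  qed
  then show ?thesis
    using mult by (simp add: representation_def hom_def units_of_carrier units_of_mult ring_mat_simps)
qed

text \<open>In dimension 1 the action substitutes \<open>\<xi>\<close> times the variable, so an
  invariant contains only degrees k with \<xi>^k = 1.\<close>

lemma linear_character_poly_action:
  assumes "f \<in> mpoly_ring 1" "\<And>i j. i < 1 \<Longrightarrow> j < 1 \<Longrightarrow> \<rho> (inv\<^bsub>G\<^esub> g) $$ (i, j) = \<xi>"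
  shows "Poly_Mapping.lookup (poly_action G 1 \<rho> g f) m = Poly_Mapping.lookup f m * \<xi> ^ mdegree m"
proof -
  let ?x = "\<lambda>i. \<Sum>j<1. mpoly_const (\<rho> (inv\<^bsub>G\<^esub> g) $$ (i, j)) * mpoly_var j"
  have x: "monomial_eval ?x m = Poly_Mapping.single m (\<xi> ^ mdegree m)" if "m \<in> Poly_Mapping.keys f" for m
  proof -
    have keys: "Poly_Mapping.keys m \<subseteq> {0}"
      using assms(1) that by (auto simp: mpoly_ring_def)
    define k where "k = Poly_Mapping.lookup m 0"
    have m: "m = Poly_Mapping.single 0 k"
      using keys by (intro poly_mapping_eqI) (auto simp: k_def lookup_single when_def in_keys_iff)
    have pow: "Poly_Mapping.single (Poly_Mapping.single 0 (1 :: nat)) \<xi> ^ k = Poly_Mapping.single (Poly_Mapping.single (0 :: nat) k) (\<xi> ^ k)" for k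
      by (induction k) (simp_all add: mult_single single_add[symmetric])
    have "?x 0 = Poly_Mapping.single (Poly_Mapping.single 0 1) \<xi>"
      using assms(2) by (simp add: mpoly_const_def mpoly_var_def mult_single)
    then have "monomial_eval ?x m = Poly_Mapping.single (Poly_Mapping.single 0 1) \<xi> ^ k"
      unfolding m monomial_eval_single by simp
    moreover have "mdegree m = k"
      by (simp add: m mdegree_def)
    ultimately show ?thesis
      by (simp add: m pow[unfolded One_nat_def])
  qed
  have "poly_action G 1 \<rho> g f
      = (\<Sum>m\<in>Poly_Mapping.keys f. mpoly_const (Poly_Mapping.lookup f m) * monomial_eval ?x m)"
    by (simp add: poly_action_def const_hom.subst_superset[OF finite_keys order_refl])
  also have "\<dots> = (\<Sum>m\<in>Poly_Mapping.keys f. Poly_Mapping.single m (Poly_Mapping.lookup f m * \<xi> ^ mdegree m))"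
    by (intro sum.cong refl) (simp only: x, simp add: mpoly_const_def mult_single)
  finally show ?thesis
    by (simp add: lookup_sum lookup_single when_def in_keys_iff)
qed

text \<open>
  A faithful character of the quotient of order 6 has no nonconstant invariants of degree below 6,
  so these do not separate 0 from 1.
\<close>

lemma beta_sep_S3C3_ge:
  assumes \<omega>: "has_mult_order (\<omega> :: 'k::field) 6"
  shows "\<exists>\<rho> :: _ \<Rightarrow> 'k mat. representation S3C3 1 \<rho> \<and> 6 \<le> beta_sep_module S3C3 1 \<rho>"
proof -
  interpret group S3C3
    by (rule group_S3C3)
  have \<omega>6: "\<omega> ^ 6 = 1" and \<omega>k: "\<And>k. 0 < k \<Longrightarrow> k < 6 \<Longrightarrow> \<omega> ^ k \<noteq> 1"
    using \<omega> by (auto simp: has_mult_order_def)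
  have \<omega>23: "(\<omega>\<^sup>2) ^ 3 = 1"
    using \<omega>6 by (simp add: power_mult[symmetric])
  \<comment> \<open>Sign on S_3 times a faithful character of C_3; the kernel is A_3 and the
    quotient C_2 x C_3 is cyclic of order 6.\<close>
  define \<chi> where "\<chi> g = of_int (sign (fst g)) * cpow (\<omega>\<^sup>2) (of_int (snd g))" for g :: "(nat \<Rightarrow> nat) \<times> int"
  have mod: "of_int (k mod 3) = (of_int k :: 3)" for k
  proof -
    have "(of_int k :: 3) = of_int (3 * (k div 3) + k mod 3)"
      by simp
    also have "\<dots> = of_int (k mod 3)"
      by (simp only: of_int_add of_int_mult of_int_numeral three_mult_3 add_0_left)
    finally show ?thesis
      by simp
  qed
  have \<chi>_mult: "\<chi> (g \<otimes>\<^bsub>S3C3\<^esub> h) = \<chi> g * \<chi> h" if "g \<in> carrier S3C3" "h \<in> carrier S3C3" for g h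
    using that
    by (cases g, cases h) (auto simp: \<chi>_def sym_group_mult sign_compose sym_group_carrier' mod cpow_add[OF \<omega>23] mult_ac)
  define \<rho> where "\<rho> g = mat 1 1 (\<lambda>_. \<chi> g)" for g
  have rho_one: "\<rho> \<one>\<^bsub>S3C3\<^esub> = 1\<^sub>m 1"
    by (auto simp: \<rho>_def \<chi>_def sym_group_one)
  have rep: "representation S3C3 1 \<rho>"
  proof (rule representationI)
    show "\<rho> \<one>\<^bsub>S3C3\<^esub> = 1\<^sub>m 1"
      by (rule rho_one)
    show "\<rho> (g \<otimes>\<^bsub>S3C3\<^esub> h) = \<rho> g * \<rho> h" if "g \<in> carrier S3C3" "h \<in> carrier S3C3" for g h
      using \<chi>_mult[OF that] by (auto simp: \<rho>_def scalar_prod_def)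
  qed (simp_all add: group_S3C3 \<rho>_def)
  define g where "g = (transpose 1 2 :: nat \<Rightarrow> nat, 1 :: int)"
  have g: "g \<in> carrier S3C3"
    using transpose_permutes
    by (simp add: g_def sym_group_carrier carrier_integer_mod_group)
  have \<omega>3: "\<omega> ^ 3 = - 1"
  proof -
    have "(\<omega> ^ 3 - 1) * (\<omega> ^ 3 + 1) = \<omega> ^ 6 - 1"
      by (simp add: algebra_simps power_add[symmetric])
    then show ?thesis
      using \<omega>6 \<omega>k[of 3] by (simp add: eq_neg_iff_add_eq_0)
  qed
  \<comment> \<open>Here \<open>\<chi> g\<close> is \<open>- \<omega>\<^sup>2\<close>, the inverse
    of \<open>\<omega>\<close>, so it has order 6.\<close>
  have \<chi>g: "\<chi> g * \<omega> = 1"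
    using \<omega>3 by (simp add: \<chi>_def g_def sign_swap_id cpow_def power3_eq_cube power2_eq_square)
  have not_sep: "\<not> separating_set S3C3 1 \<rho> {f \<in> invariants S3C3 1 \<rho>. total_degree f \<le> d}" if d: "d < 6" for d
  proof
    assume sep: "separating_set S3C3 1 \<rho> {f \<in> invariants S3C3 1 \<rho>. total_degree f \<le> d}"
    define v w where "v = (0\<^sub>v 1 :: 'k vec)" and "w = vec 1 (\<lambda>_. 1 :: 'k)"
    have vw: "v \<in> carrier_vec 1" "w \<in> carrier_vec 1"
      by (simp_all add: v_def w_def)
    have "w = \<rho> \<one>\<^bsub>S3C3\<^esub> *\<^sub>v w"
      unfolding rho_one using vw(2) by simp
    then have "w \<in> module_orbit S3C3 \<rho> w"
      unfolding module_orbit_def orbit_def using one_closed by blast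
    moreover have "w \<notin> module_orbit S3C3 \<rho> v"
    proof
      assume "w \<in> module_orbit S3C3 \<rho> v"
      then obtain h where "w = \<rho> h *\<^sub>v v"
        by (auto simp: module_orbit_def orbit_def)
      then have "w $ 0 = (\<rho> h *\<^sub>v v) $ 0"
        by simp
      then show False
        by (simp add: \<rho>_def v_def w_def scalar_prod_def)
    qed
    ultimately obtain f where f: "f \<in> invariants S3C3 1 \<rho>" "total_degree f \<le> d"
      and neq: "mpoly_eval f v \<noteq> mpoly_eval f w"
      using sep vw unfolding separating_set_def by blast
    have "Poly_Mapping.keys f \<subseteq> {0}"
    proof
      fix m assume m: "m \<in> Poly_Mapping.keys f"
      \<comment> \<open>The action of an element substitutes with the matrix of its inverse, so
        \<open>inv g\<close> is taken in order to obtain \<open>\<chi> g\<close>.\<close>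
      have fr: "f \<in> mpoly_ring 1" and inv: "poly_action S3C3 1 \<rho> (inv\<^bsub>S3C3\<^esub> g) f = f"
        using f inv_closed[OF g] unfolding invariants_def by blast+
      have "Poly_Mapping.lookup f m * \<chi> g ^ mdegree m = Poly_Mapping.lookup f m"
        using linear_character_poly_action[OF fr, of \<rho> S3C3 "inv\<^bsub>S3C3\<^esub> g" "\<chi> g" m] g
        by (simp add: inv[unfolded One_nat_def] \<rho>_def del: inv_DirProd)
      then have "\<chi> g ^ mdegree m = 1"
        using m by (simp add: in_keys_iff)
      then have "\<omega> ^ mdegree m = 1"
        using \<chi>g power_mult_distrib[of "\<chi> g" \<omega> "mdegree m"] by simp
      moreover have "mdegree m < 6"
        using f(2) m d by (auto simp: total_degree_le_iff)
      ultimately have "mdegree m = 0"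
        using \<omega>k by blast
      then show "m \<in> {0}"
        by (auto simp: mdegree_def in_keys_iff intro!: poly_mapping_eqI)
    qed
    then have "mpoly_eval f x = Poly_Mapping.lookup f 0" for x
      by (simp add: mpoly_eval_def eval_hom.subst_superset[of "{0}"])
    then show False
      using neq by simp
  qed
  have "6 \<le> beta_sep_module S3C3 1 \<rho>"
    unfolding beta_sep_module_def
  proof (rule Inf_greatest)
    fix x assume "x \<in> {enat d |d. 0 < d \<and> separating_set S3C3 1 \<rho> {f \<in> invariants S3C3 1 \<rho>. total_degree f \<le> d}}"
    then obtain d where "x = enat d" "\<not> d < 6"
      using not_sep by blast
    then show "6 \<le> x"
      by (simp add: numeral_eq_enat)
  qed
  then show ?thesis
    using rep by blast
qed

theorem theorem5p8:
  assumes "\<exists>\<omega> :: 'k::field. has_mult_order \<omega> 6"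
  shows "beta_sep TYPE('k) (sym_group 3 \<times>\<times> integer_mod_group 3) = 6"
proof (rule antisym)
  obtain \<omega> :: 'k where \<omega>: "has_mult_order \<omega> 6"
    using assms by blast
  have \<omega>6: "\<omega> ^ 6 = 1" and \<omega>k: "\<And>k. 0 < k \<Longrightarrow> k < 6 \<Longrightarrow> \<omega> ^ k \<noteq> 1"
    using \<omega> by (auto simp: has_mult_order_def)
  define z where "z = \<omega>\<^sup>2"
  have z: "z ^ 3 = 1" "z \<noteq> 1"
    using \<omega>6 \<omega>k[of 2] by (simp_all add: z_def power_mult[symmetric])
  have two: "(2 :: 'k) \<noteq> 0"
  proof
    assume "(2 :: 'k) = 0"
    \<comment> \<open>In characteristic 2 the polynomial X^6 - 1 is the square of X^3 - 1, so no
      element has order 6.\<close>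
    then have "(\<omega> ^ 3 - 1) * (\<omega> ^ 3 - 1) = \<omega> ^ 6 - 1"
      by (simp add: algebra_simps power_add[symmetric] mult_2[symmetric])
    then show False
      using \<omega>6 \<omega>k[of 3] by simp
  qed
  have three: "(3 :: 'k) \<noteq> 0"
  proof
    assume three: "(3 :: 'k) = 0"
    \<comment> \<open>In characteristic 3 the only cube root of unity is 1.\<close>
    have "(z - 1) * (z - 1) = (z\<^sup>2 + z + 1) - 3 * z"
      by (simp add: algebra_simps power2_eq_square)
    then show False
      using z cube_root_of_unity_sum[OF z] three by simp
  qed
  have "beta_sep_module S3C3 n \<rho> \<le> 6" if "representation S3C3 n \<rho>" for n and \<rho> :: "_ \<Rightarrow> 'k mat"
    using split_representation.beta_sep_module_le[OF split_representation_S3C3[OF that z two three]] .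
  then show "beta_sep TYPE('k) S3C3 \<le> 6"
    unfolding beta_sep_def by (intro Sup_least) blast
  show "6 \<le> beta_sep TYPE('k) S3C3"
    using beta_sep_S3C3_ge[OF \<omega>] unfolding beta_sep_def by (blast intro: Sup_upper2)
qed

end
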